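(* For the Lamplighter group $C_2\wr\mathbb Z$, let $c(m)$ be the coefficient of $z^m$ in the conjugacy growth series $\tilde\sigma_{(C_2\wr\mathbb Z,\vec Y)}(z)$. Then $$\lim_{m\to\infty}\frac{c(m)}{\frac{2}{m}\left(\frac{1+\sqrt5}{2}\right)^m}=1 .$$
   Context: $C_2\wr\mathbb Z=\bigl(\bigoplus_{i\in\mathbb Z}C_2\bigr)\rtimes\mathbb Z$, where $\mathbb Z=\langle a\rangle$ acts by translation of coordinates: $(\eta,m)(\theta,n)=(\eta\theta^m,mn)$ with $\theta^m(i)=\theta(m^{-1}i)$. The generating set is $\vec Y=\{(\vec e,a),(\vec e,a^{-1}),(\vec y,e')\}$, where $e'$ is the neutral element of $\mathbb Z$, $\vec e$ is the trivial element of $\bigoplus_{i\in\mathbb Z}C_2$, and $\vec y$ has the generator $y$ of $C_2$ at position $e'$ and the trivial element elsewhere. The length of a conjugacy class is the minimum word length (with respect to $\vec Y$) of its elements, and the conjugacy growth series $\tilde\sigma_{(C_2\wr\mathbb Z,\vec Y)}(z)$ is the power series whose coefficient of $z^m$ is the number of conjugacy classes of length $m$. *)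

theory Defs
  imports
    "HOL-Analysis.Analysis"
    "HOL-Algebra.Algebra"
    "HOL-Computational_Algebra.Formal_Power_Series"
begin

subsection \<open>Restricted wreath products\<close>

definition translate :: "('b, 'm) monoid_scheme \<Rightarrow> 'b \<Rightarrow> ('b \<Rightarrow> 'a) \<Rightarrow> 'b \<Rightarrow> 'a" where
  "translate G m \<theta> = (\<lambda>i\<in>carrier G. \<theta> (inv\<^bsub>G\<^esub> m \<otimes>\<^bsub>G\<^esub> i))"

definition wreath_product ::
  "('a, 'm) monoid_scheme \<Rightarrow> ('b, 'n) monoid_scheme \<Rightarrow> (('b \<Rightarrow> 'a) \<times> 'b) monoid" where
  "wreath_product L G =
     \<lparr>carrier = carrier (sum_group (carrier G) (\<lambda>_. L)) \<times> carrier G,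
      monoid.mult = (\<lambda>(\<eta>, m) (\<theta>, n).
         (\<eta> \<otimes>\<^bsub>sum_group (carrier G) (\<lambda>_. L)\<^esub> translate G m \<theta>, m \<otimes>\<^bsub>G\<^esub> n)),
      one = (\<one>\<^bsub>sum_group (carrier G) (\<lambda>_. L)\<^esub>, \<one>\<^bsub>G\<^esub>)\<rparr>"

subsection \<open>Conjugacy growth\<close>

text \<open>
  Words use only letters of \<open>S\<close>, not their inverses, so \<open>S\<close> is meant to generate
  \<open>G\<close> as a monoid. On elements not represented by a word, the value of \<open>LEAST\<close> is
  meaningless.
\<close>

definition word_length :: "('a, 'm) monoid_scheme \<Rightarrow> 'a set \<Rightarrow> 'a \<Rightarrow> nat" where
  "word_length G S g =
     (LEAST n. \<exists>w. set w \<subseteq> S \<and> length w = n \<and> foldr (\<otimes>\<^bsub>G\<^esub>) w \<one>\<^bsub>G\<^esub> = g)"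

definition conjugacy_classes :: "('a, 'm) monoid_scheme \<Rightarrow> 'a set set" where
  "conjugacy_classes G =
     orbits G (carrier G) (\<lambda>g. \<lambda>h\<in>carrier G. g \<otimes>\<^bsub>G\<^esub> h \<otimes>\<^bsub>G\<^esub> inv\<^bsub>G\<^esub> g)"

definition class_length :: "('a, 'm) monoid_scheme \<Rightarrow> 'a set \<Rightarrow> 'a set \<Rightarrow> nat" where
  "class_length G S C = (LEAST n. n \<in> word_length G S ` C)"

definition conjugacy_growth_series :: "('a, 'm) monoid_scheme \<Rightarrow> 'a set \<Rightarrow> nat fps" where
  "conjugacy_growth_series G S =
     Abs_fps (\<lambda>m. card {C \<in> conjugacy_classes G. class_length G S C = m})"

subsection \<open>The lamplighter group\<close>

definition lamplighter :: "((int \<Rightarrow> int) \<times> int) monoid" where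
  "lamplighter = wreath_product (integer_mod_group 2) integer_group"

text \<open>
  The generators of \<open>C\<^sub>2 = {0, 1}\<close> and of the infinite cyclic group \<open>\<int>\<close> are both \<open>1\<close>,
  as the two groups are written additively.
\<close>

definition lamplighter_gens :: "((int \<Rightarrow> int) \<times> int) set" where
  "lamplighter_gens =
     {(\<lambda>i. 0, 1), (\<lambda>i. 0, -1), (\<lambda>i. if i = 0 then 1 else 0, 0)}"

subsection \<open>Well-definedness\<close>

lemma carrier_lamplighter:
  "carrier lamplighter = {\<eta>. range \<eta> \<subseteq> {0, 1} \<and> finite {i. \<eta> i \<noteq> 0}} \<times> UNIV"
proof -
  have "{0..<int 2} = {0, 1}" by auto
  then show ?thesis
    by (auto simp: lamplighter_def wreath_product_def carrier_sum_group
        carrier_integer_mod_group PiE_iff)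
qed

lemma mult_lamplighter:
  "(\<eta>, m) \<otimes>\<^bsub>lamplighter\<^esub> (\<theta>, n) = (\<lambda>i. (\<eta> i + \<theta> (i - m)) mod 2, m + n)"
  by (simp add: lamplighter_def wreath_product_def translate_def restrict_def)

lemma one_lamplighter: "\<one>\<^bsub>lamplighter\<^esub> = (\<lambda>i. 0, 0)"
  by (simp add: lamplighter_def wreath_product_def restrict_def)

lemma group_lamplighter: "group lamplighter"
proof (rule groupI)
  fix x y assume "x \<in> carrier lamplighter" "y \<in> carrier lamplighter"
  then obtain \<eta> m \<theta> n where x: "x = (\<eta>, m)" and y: "y = (\<theta>, n)"
    and f: "finite {i. \<eta> i \<noteq> 0}" "finite {i. \<theta> i \<noteq> 0}"
    by (auto simp: carrier_lamplighter)
  have "{i. (\<eta> i + \<theta> (i - m)) mod 2 \<noteq> 0} \<subseteq> {i. \<eta> i \<noteq> 0} \<union> (\<lambda>i. i + m) ` {i. \<theta> i \<noteq> 0}"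
  proof
    fix i assume "i \<in> {i. (\<eta> i + \<theta> (i - m)) mod 2 \<noteq> 0}"
    then have "\<eta> i \<noteq> 0 \<or> \<theta> (i - m) \<noteq> 0" by auto
    moreover have "i = (i - m) + m" by simp
    ultimately show "i \<in> {i. \<eta> i \<noteq> 0} \<union> (\<lambda>i. i + m) ` {i. \<theta> i \<noteq> 0}" by blast
  qed
  then have "finite {i. (\<eta> i + \<theta> (i - m)) mod 2 \<noteq> 0}"
    using f finite_subset by blast
  then show "x \<otimes>\<^bsub>lamplighter\<^esub> y \<in> carrier lamplighter"
    by (auto simp: x y mult_lamplighter carrier_lamplighter)
next
  show "\<one>\<^bsub>lamplighter\<^esub> \<in> carrier lamplighter"
    by (simp add: one_lamplighter carrier_lamplighter image_subset_iff)
next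
  fix x y z
  show "x \<otimes>\<^bsub>lamplighter\<^esub> y \<otimes>\<^bsub>lamplighter\<^esub> z = x \<otimes>\<^bsub>lamplighter\<^esub> (y \<otimes>\<^bsub>lamplighter\<^esub> z)"
    by (cases x; cases y; cases z)
      (simp add: mult_lamplighter mod_add_left_eq mod_add_right_eq add.assoc diff_diff_eq)
next
  fix x assume x: "x \<in> carrier lamplighter"
  then obtain \<eta> m where xe: "x = (\<eta>, m)" by (cases x)
  have r: "\<eta> i = 0 \<or> \<eta> i = 1" for i
    using x by (auto simp: xe carrier_lamplighter)
  then have "\<eta> i mod 2 = \<eta> i" for i
    by (metis mod_0 one_mod_two_eq_one)
  then show "\<one>\<^bsub>lamplighter\<^esub> \<otimes>\<^bsub>lamplighter\<^esub> x = x"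
    by (simp add: xe one_lamplighter mult_lamplighter)
  have "{i. \<eta> (i + m) \<noteq> 0} = (\<lambda>i. i - m) ` {i. \<eta> i \<noteq> 0}"
  proof
    show "{i. \<eta> (i + m) \<noteq> 0} \<subseteq> (\<lambda>i. i - m) ` {i. \<eta> i \<noteq> 0}"
    proof
      fix i assume "i \<in> {i. \<eta> (i + m) \<noteq> 0}"
      then show "i \<in> (\<lambda>i. i - m) ` {i. \<eta> i \<noteq> 0}"
        by (intro image_eqI[of _ _ "i + m"]) simp_all
    qed
  qed auto
  then have "finite {i. \<eta> (i + m) \<noteq> 0}"
    using x by (auto simp: xe carrier_lamplighter)
  then have "(\<lambda>i. \<eta> (i + m), -m) \<in> carrier lamplighter"
    using r by (auto simp: carrier_lamplighter)
  moreover have "(\<lambda>i. \<eta> (i + m), -m) \<otimes>\<^bsub>lamplighter\<^esub> x = \<one>\<^bsub>lamplighter\<^esub>"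
    by (simp add: xe one_lamplighter mult_lamplighter)
  ultimately show "\<exists>y\<in>carrier lamplighter. y \<otimes>\<^bsub>lamplighter\<^esub> x = \<one>\<^bsub>lamplighter\<^esub>" ..
qed

lemma lamplighter_word:
  assumes "g \<in> carrier lamplighter"
  shows "\<exists>w. set w \<subseteq> lamplighter_gens \<and> foldr (\<otimes>\<^bsub>lamplighter\<^esub>) w \<one>\<^bsub>lamplighter\<^esub> = g"
proof -
  interpret group lamplighter by (rule group_lamplighter)
  define W where
    "W = {g. \<exists>w. set w \<subseteq> lamplighter_gens \<and> foldr (\<otimes>\<^bsub>lamplighter\<^esub>) w \<one>\<^bsub>lamplighter\<^esub> = g}"
  have step: "s \<otimes>\<^bsub>lamplighter\<^esub> g \<in> W" if "s \<in> lamplighter_gens" "g \<in> W" for s g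
  proof -
    from that obtain w where "set w \<subseteq> lamplighter_gens"
      "foldr (\<otimes>\<^bsub>lamplighter\<^esub>) w \<one>\<^bsub>lamplighter\<^esub> = g" by (auto simp: W_def)
    then show ?thesis
      using that(1) unfolding W_def by (intro CollectI exI[of _ "s # w"]) simp
  qed
  have "\<one>\<^bsub>lamplighter\<^esub> \<in> W" unfolding W_def by (intro CollectI exI[of _ "[]"]) simp
  then have zero: "(\<lambda>i. 0, 0) \<in> W" by (simp only: one_lamplighter)
  have modid: "(\<lambda>i. \<eta> i mod 2) = \<eta>" if "range \<eta> \<subseteq> {0, 1}" for \<eta> :: "int \<Rightarrow> int"
  proof
    fix i
    have "\<eta> i \<in> {0, 1}" using that by blast
    then show "\<eta> i mod 2 = \<eta> i" by auto
  qed
  have shift: "(\<lambda>i. \<eta> (i - k), m + k) \<in> W" if "(\<eta>, m) \<in> W" "range \<eta> \<subseteq> {0, 1}" for \<eta> m k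
  proof (induction k rule: int_induct[where k = 0])
    case base
    then show ?case using that by simp
  next
    case (step1 k)
    have "(\<lambda>i. 0, 1) \<otimes>\<^bsub>lamplighter\<^esub> (\<lambda>i. \<eta> (i - k), m + k) \<in> W"
      by (rule step) (use step1 in \<open>auto simp: lamplighter_gens_def\<close>)
    moreover have "(\<lambda>i. \<eta> (i - 1 - k) mod 2) = (\<lambda>i. \<eta> (i - 1 - k))"
      by (rule modid) (use that(2) in auto)
    moreover have "i - 1 - k = i - (k + 1)" for i by simp
    moreover have "1 + (m + k) = m + (k + 1)" by simp
    ultimately show ?case by (simp only: mult_lamplighter add_0)
  next
    case (step2 k)
    have "(\<lambda>i. 0, -1) \<otimes>\<^bsub>lamplighter\<^esub> (\<lambda>i. \<eta> (i - k), m + k) \<in> W"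
      by (rule step) (use step2 in \<open>auto simp: lamplighter_gens_def\<close>)
    moreover have "(\<lambda>i. \<eta> (i - (-1) - k) mod 2) = (\<lambda>i. \<eta> (i - (-1) - k))"
      by (rule modid) (use that(2) in auto)
    moreover have "i - (-1) - k = i - (k - 1)" for i by simp
    moreover have "-1 + (m + k) = m + (k - 1)" by simp
    ultimately show ?case by (simp only: mult_lamplighter add_0)
  qed
  have lamp: "(\<lambda>i. of_bool (i \<in> A), m) \<in> W" if "finite A" for A m
    using that
  proof (induction A arbitrary: m rule: finite_induct)
    case empty
    show ?case using shift[OF zero, of m] by simp
  next
    case (insert a A)
    have r: "range (\<lambda>i. of_bool (P i) :: int) \<subseteq> {0, 1}" for P :: "int \<Rightarrow> bool" by auto
    have "(\<lambda>i. of_bool (i + a \<in> A), m - a) \<in> W"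
      using shift[OF insert.IH[of m] r, of "-a"] by simp
    then have "(\<lambda>i. if i = 0 then 1 else 0, 0) \<otimes>\<^bsub>lamplighter\<^esub> (\<lambda>i. of_bool (i + a \<in> A), m - a) \<in> W"
      by (intro step) (auto simp: lamplighter_gens_def)
    moreover have "(\<lambda>i. if i = 0 then 1 else 0, 0) \<otimes>\<^bsub>lamplighter\<^esub> (\<lambda>i. of_bool (i + a \<in> A), m - a)
        = (\<lambda>i. of_bool (i + a \<in> insert a A), m - a)"
      using insert.hyps by (simp add: mult_lamplighter fun_eq_iff)
    ultimately have "(\<lambda>i. of_bool (i + a \<in> insert a A), m - a) \<in> W" by (simp only:)
    from shift[OF this r, of a] show ?case by simp
  qed
  obtain \<eta> m where g: "g = (\<eta>, m)" by (cases g)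
  have "\<eta> i = of_bool (i \<in> {i. \<eta> i \<noteq> 0})" for i
  proof -
    have "\<eta> i \<in> {0, 1}" using assms by (auto simp: g carrier_lamplighter)
    then show ?thesis by auto
  qed
  then have "\<eta> = (\<lambda>i. of_bool (i \<in> {i. \<eta> i \<noteq> 0}))" by (rule ext)
  moreover have "finite {i. \<eta> i \<noteq> 0}" using assms by (auto simp: g carrier_lamplighter)
  ultimately have "g \<in> W" using lamp[of "{i. \<eta> i \<noteq> 0}" m] by (simp only: g)
  then show ?thesis by (simp add: W_def)
qed

lemma finite_lamplighter_classes:
  "finite {C \<in> conjugacy_classes lamplighter. class_length lamplighter lamplighter_gens C = m}"
proof -
  let ?\<phi> = "\<lambda>g. \<lambda>h\<in>carrier lamplighter.
    g \<otimes>\<^bsub>lamplighter\<^esub> h \<otimes>\<^bsub>lamplighter\<^esub> inv\<^bsub>lamplighter\<^esub> g"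
  interpret group_action lamplighter "carrier lamplighter" ?\<phi>
    by (rule group.action_by_conjugation[OF group_lamplighter])
  let ?w = "\<lambda>w. foldr (\<otimes>\<^bsub>lamplighter\<^esub>) w \<one>\<^bsub>lamplighter\<^esub>"
  let ?F = "{w. set w \<subseteq> lamplighter_gens \<and> length w = m}"
  have "finite lamplighter_gens" by (simp add: lamplighter_gens_def)
  then have fin: "finite ?F" by (rule finite_lists_length_eq)
  have "{C \<in> conjugacy_classes lamplighter. class_length lamplighter lamplighter_gens C = m}
      \<subseteq> (\<lambda>w. orbit lamplighter ?\<phi> (?w w)) ` ?F"
  proof
    fix C assume C: "C \<in> {C \<in> conjugacy_classes lamplighter.
      class_length lamplighter lamplighter_gens C = m}"
    then obtain x where x: "x \<in> carrier lamplighter" "C = orbit lamplighter ?\<phi> x"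
      by (auto simp: conjugacy_classes_def orbits_def)
    have "x \<in> C" using orbit_refl[OF x(1)] x(2) by simp
    then have "\<exists>n. n \<in> word_length lamplighter lamplighter_gens ` C" by blast
    then have "m \<in> word_length lamplighter lamplighter_gens ` C"
      using C LeastI_ex[of "\<lambda>n. n \<in> word_length lamplighter lamplighter_gens ` C"]
      by (simp add: class_length_def)
    then obtain y where y: "y \<in> C" "word_length lamplighter lamplighter_gens y = m" by auto
    from y(1) obtain h where h: "h \<in> carrier lamplighter" "?\<phi> h x = y"
      unfolding x(2) orbit_def by blast
    have yc: "y \<in> carrier lamplighter" by (rule element_image[OF h(1) x(1) h(2)])
    have "\<exists>n w. set w \<subseteq> lamplighter_gens \<and> length w = n \<and> ?w w = y"
      using lamplighter_word[OF yc] by blast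
    from LeastI_ex[OF this] obtain w where w: "w \<in> ?F" "?w w = y"
      using y(2) by (auto simp: word_length_def)
    have "C = orbit lamplighter ?\<phi> y"
    proof -
      have "orbit lamplighter ?\<phi> y \<in> orbits lamplighter (carrier lamplighter) ?\<phi>"
        using yc unfolding orbits_def by blast
      moreover have "C \<in> orbits lamplighter (carrier lamplighter) ?\<phi>"
        using C by (simp add: conjugacy_classes_def)
      ultimately show ?thesis
        using disjoint_union[of C "orbit lamplighter ?\<phi> y"] y(1) orbit_refl[OF yc] by blast
    qed
    then show "C \<in> (\<lambda>w. orbit lamplighter ?\<phi> (?w w)) ` ?F"
      using w by blast
  qed
  then show ?thesis by (rule finite_subset[OF _ finite_imageI[OF fin]])
qed

end

theory Submission
  imports Defs "HOL-Number_Theory.Fib"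
begin

text \<open>
Write an element of the lamplighter group as \<open>lamp A m\<close>: the lamps in the finite set \<open>A\<close> are on and
the lamplighter ends at \<open>m\<close>. The conjugacy classes split according to \<open>m\<close>, which is a class invariant.

For \<open>m \<noteq> 0\<close>, conjugation by a lamp configuration moves lamps by multiples of \<open>m\<close>, so only the parity of
the number of lit lamps in each residue class modulo \<open>m\<close> matters, and conjugation by translations
rotates the residues (\<open>conjugate_iff_parity_set\<close>). The classes are therefore the binary necklaces with
\<open>M = \<bar>m\<bar>\<close> beads: subsets \<open>U\<close> of the window \<open>{0..<M}\<close> up to rotation. A shortest word walks once through the
window and switches on each lamp of \<open>U\<close> on the way, so the class has length \<open>M + card U\<close>
(\<open>class_length_window\<close>).

Most subsets of the window have \<open>M\<close> different rotations. The others have a rotational symmetry by some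
\<open>d \<le> M / 2\<close> and are determined by \<open>d\<close> of their elements, so there are only \<open>O(2 powr (M / 2))\<close> of them. Up to this
error there are \<open>(M choose (n - M)) / M\<close> classes of length \<open>n\<close> for each of \<open>m = M\<close> and \<open>m = - M\<close>, and the sum of
these numbers over \<open>M\<close> is the Lucas number \<open>fib (n + 1) + fib (n - 1) = \<phi> ^ n + \<psi> ^ n\<close> divided by \<open>n\<close>
(\<open>lucas_sum\<close>, \<open>lucas_closed_form\<close>). This gives the main term \<open>2 / n * \<phi> ^ n\<close>.

For \<open>m = 0\<close> a class is a finite set of lamps up to translation. A word of length \<open>n\<close> is a closed walk, so
the lamps lie in a window of about \<open>n / 2\<close> positions, and there are only \<open>O(2 powr (n / 2))\<close> such classes
(\<open>card_torsion_classes\<close>). As \<open>sqrt 2 < \<phi>\<close>, both error terms vanish in the limit.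
\<close>

section \<open>Lamp configurations and words\<close>

definition lamp :: "int set \<Rightarrow> int \<Rightarrow> (int \<Rightarrow> int) \<times> int" where
  "lamp A m = (\<lambda>i. of_bool (i \<in> A), m)"

definition shift :: "int \<Rightarrow> int set \<Rightarrow> int set" where
  "shift k A = {i. i - k \<in> A}"

text \<open>
Symmetric difference, in a form that reduces equations between such sets to propositional reasoning
about a single position.
\<close>

definition toggle :: "int set \<Rightarrow> int set \<Rightarrow> int set" where
  "toggle A B = {i. (i \<in> A) \<noteq> (i \<in> B)}"

lemma shift_eq_image: "shift k A = (\<lambda>i. i + k) ` A"
proof (intro Set.set_eqI iffI)
  fix i assume "i \<in> shift k A"
  then show "i \<in> (\<lambda>i. i + k) ` A"
    by (intro image_eqI[of _ _ "i - k"]) (simp_all add: shift_def)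
qed (auto simp: shift_def)

lemma finite_shift: "finite A \<Longrightarrow> finite (shift k A)"
  by (simp add: shift_eq_image)

lemma card_shift: "card (shift k A) = card A"
  by (simp add: shift_eq_image card_image)

lemma shift_0: "shift 0 A = A"
  by (simp add: shift_def)

lemma finite_toggle: "finite A \<Longrightarrow> finite B \<Longrightarrow> finite (toggle A B)"
  by (rule finite_subset[of _ "A \<union> B"]) (auto simp: toggle_def)

lemma toggle_empty: "toggle {} A = A"
  by (simp add: toggle_def)

lemma finite_window: "U \<subseteq> {0..<k} \<Longrightarrow> finite U" for k :: int
  by (erule finite_subset) simp

lemma lamp_eq_iff: "lamp A m = lamp B n \<longleftrightarrow> A = B \<and> m = n"
  by (auto simp: lamp_def fun_eq_iff)

lemma carrier_lamp_iff: "x \<in> carrier lamplighter \<longleftrightarrow> (\<exists>A m. finite A \<and> x = lamp A m)"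
proof
  assume x: "x \<in> carrier lamplighter"
  then obtain \<eta> m where xe: "x = (\<eta>, m)" and f: "finite {i. \<eta> i \<noteq> 0}" and r: "range \<eta> \<subseteq> {0, 1}"
    by (auto simp: carrier_lamplighter)
  have "\<eta> i = of_bool (i \<in> {i. \<eta> i \<noteq> 0})" for i
  proof -
    have "\<eta> i \<in> {0, 1}" using r by blast
    then show ?thesis by auto
  qed
  then have "x = lamp {i. \<eta> i \<noteq> 0} m"
    by (simp add: xe lamp_def fun_eq_iff)
  with f show "\<exists>A m. finite A \<and> x = lamp A m" by blast
next
  assume "\<exists>A m. finite A \<and> x = lamp A m"
  then show "x \<in> carrier lamplighter"
    by (auto simp: carrier_lamplighter lamp_def)
qed

lemma lamp_in_carrier: "lamp A m \<in> carrier lamplighter \<longleftrightarrow> finite A"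
  by (auto simp: carrier_lamp_iff lamp_eq_iff)

lemma mult_lamp: "lamp A m \<otimes>\<^bsub>lamplighter\<^esub> lamp B n = lamp (toggle A (shift m B)) (m + n)"
  by (auto simp: lamp_def mult_lamplighter toggle_def shift_def fun_eq_iff)

lemma one_lamp: "\<one>\<^bsub>lamplighter\<^esub> = lamp {} 0"
  by (simp add: one_lamplighter lamp_def)

lemma gens_lamp: "lamplighter_gens = {lamp {} 1, lamp {} (-1), lamp {0} 0}"
proof -
  have "(\<lambda>i. if i = 0 then 1 else 0 :: int) = (\<lambda>i::int. of_bool (i \<in> {0}))" by auto
  then show ?thesis by (simp add: lamplighter_gens_def lamp_def)
qed

text \<open>
The group elements that are products of \<open>n\<close> generators, built by multiplying with a generator from the
left. The right factor is then translated, which is why the lamps move rather than the lamplighter.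
\<close>

inductive spells :: "nat \<Rightarrow> int set \<Rightarrow> int \<Rightarrow> bool" where
  empty: "spells 0 {} 0"
| right: "spells n A m \<Longrightarrow> spells (Suc n) (shift 1 A) (m + 1)"
| left: "spells n A m \<Longrightarrow> spells (Suc n) (shift (-1) A) (m - 1)"
| switch: "spells n A m \<Longrightarrow> spells (Suc n) (toggle {0} A) m"

lemma word_iff_spells:
  "(\<exists>w. set w \<subseteq> lamplighter_gens \<and> length w = n \<and>
      foldr (\<otimes>\<^bsub>lamplighter\<^esub>) w \<one>\<^bsub>lamplighter\<^esub> = lamp A m) \<longleftrightarrow> spells n A m"
  (is "?W n A m \<longleftrightarrow> _")
proof
  assume "?W n A m"
  then obtain w where "set w \<subseteq> lamplighter_gens" "length w = n"
    "foldr (\<otimes>\<^bsub>lamplighter\<^esub>) w \<one>\<^bsub>lamplighter\<^esub> = lamp A m" by blast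
  then show "spells n A m"
  proof (induction w arbitrary: n A m)
    case Nil
    then have "n = 0" "A = {}" "m = 0" by (simp_all add: one_lamp lamp_eq_iff)
    then show ?case by (simp add: spells.empty)
  next
    case (Cons s w)
    have "foldr (\<otimes>\<^bsub>lamplighter\<^esub>) w \<one>\<^bsub>lamplighter\<^esub> \<in> range (\<lambda>(B, k). lamp B k)" (is "?v \<in> _")
    proof -
      have "set w \<subseteq> lamplighter_gens" using Cons.prems by simp
      then show ?thesis
      proof (induction w)
        case Nil
        then show ?case by (auto simp: one_lamp)
      next
        case (Cons t w)
        then obtain B k where "foldr (\<otimes>\<^bsub>lamplighter\<^esub>) w \<one>\<^bsub>lamplighter\<^esub> = lamp B k" by auto
        then show ?case
          using Cons.prems by (auto simp: gens_lamp mult_lamp image_iff lamp_eq_iff)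
      qed
    qed
    then obtain B k where v: "?v = lamp B k" by auto
    with Cons have "spells (length w) B k" by simp
    moreover have "lamp A m = s \<otimes>\<^bsub>lamplighter\<^esub> lamp B k" "s \<in> lamplighter_gens" "n = Suc (length w)"
      using Cons.prems v by simp_all
    ultimately show ?case
      using spells.right[of "length w" B k] spells.left[of "length w" B k]
        spells.switch[of "length w" B k]
      by (auto simp: gens_lamp mult_lamp lamp_eq_iff toggle_empty shift_0 add.commute)
  qed
next
  have cons: "?W (Suc n) A m"
    if "?W n B k" "s \<in> lamplighter_gens" "s \<otimes>\<^bsub>lamplighter\<^esub> lamp B k = lamp A m" for n B k s A m
  proof -
    from that(1) obtain w where "set w \<subseteq> lamplighter_gens" "length w = n"
      "foldr (\<otimes>\<^bsub>lamplighter\<^esub>) w \<one>\<^bsub>lamplighter\<^esub> = lamp B k" by blast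
    with that(2,3) show ?thesis by (intro exI[of _ "s # w"]) simp
  qed
  assume "spells n A m"
  then show "?W n A m"
  proof induction
    case empty
    then show ?case by (intro exI[of _ "[]"]) (simp add: one_lamp)
  next
    case (right n A m)
    then show ?case
      by (intro cons[where s = "lamp {} 1" and B = A and k = m]) (simp_all add: gens_lamp mult_lamp toggle_empty add.commute)
  next
    case (left n A m)
    then show ?case
      by (intro cons[where s = "lamp {} (-1)" and B = A and k = m]) (simp_all add: gens_lamp mult_lamp toggle_empty)
  next
    case (switch n A m)
    then show ?case
      by (intro cons[where s = "lamp {0} 0" and B = A and k = m]) (simp_all add: gens_lamp mult_lamp shift_0)
  qed
qed

lemma word_length_lamp:
  "word_length lamplighter lamplighter_gens (lamp A m) = (LEAST n. spells n A m)"
  by (simp add: word_length_def word_iff_spells)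

lemma spells_exists: "finite A \<Longrightarrow> \<exists>n. spells n A m"
  using lamplighter_word[of "lamp A m"] word_iff_spells[of _ A m] by (auto simp: carrier_lamp_iff lamp_eq_iff)

section \<open>Conjugacy classes of lamp configurations\<close>

text \<open>
This is the equation \<open>g * lamp A m = lamp B m * g\<close> for \<open>g = lamp T k\<close>, with the inverse cleared. The
translation part \<open>m\<close> is the same on both sides because the group of translations is abelian.
\<close>

definition conjugate :: "int \<Rightarrow> int set \<Rightarrow> int set \<Rightarrow> bool" where
  "conjugate m A B \<longleftrightarrow> (\<exists>T k. finite T \<and> toggle T (shift k A) = toggle B (shift m T))"

lemma conjugate_refl: "conjugate m A A"
  unfolding conjugate_def by (intro exI[of _ "{}"] exI[of _ 0]) (auto simp: toggle_def shift_def)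

lemma conjugate_shift: "conjugate m A (shift k A)"
  unfolding conjugate_def by (intro exI[of _ "{}"] exI[of _ k]) (auto simp: toggle_def shift_def)

definition conj_action ::
  "(int \<Rightarrow> int) \<times> int \<Rightarrow> (int \<Rightarrow> int) \<times> int \<Rightarrow> (int \<Rightarrow> int) \<times> int" where
  "conj_action = (\<lambda>g. \<lambda>h\<in>carrier lamplighter. g \<otimes>\<^bsub>lamplighter\<^esub> h \<otimes>\<^bsub>lamplighter\<^esub> inv\<^bsub>lamplighter\<^esub> g)"

definition lamp_class :: "int \<Rightarrow> int set \<Rightarrow> ((int \<Rightarrow> int) \<times> int) set" where
  "lamp_class m A = {lamp B m | B. finite B \<and> conjugate m A B}"

lemma orbit_lamp:
  assumes "finite A"
  shows "orbit lamplighter conj_action (lamp A m) = lamp_class m A"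
proof -
  interpret L: group lamplighter by (rule group_lamplighter)
  have eq: "conj_action (lamp T k) (lamp A m) = lamp B n \<longleftrightarrow>
      n = m \<and> toggle T (shift k A) = toggle B (shift m T)"
    if "finite T" "finite B" for T k B n
  proof -
    have "conj_action (lamp T k) (lamp A m) = lamp B n \<longleftrightarrow>
        lamp T k \<otimes>\<^bsub>lamplighter\<^esub> lamp A m = lamp B n \<otimes>\<^bsub>lamplighter\<^esub> lamp T k"
      using that assms L.inv_solve_right'[of "lamp B n" "lamp T k \<otimes>\<^bsub>lamplighter\<^esub> lamp A m" "lamp T k"]
      by (auto simp: lamp_in_carrier conj_action_def)
    also have "\<dots> \<longleftrightarrow> n = m \<and> toggle T (shift k A) = toggle B (shift m T)"
      by (auto simp: mult_lamp lamp_eq_iff)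
    finally show ?thesis .
  qed
  show ?thesis
  proof (intro Set.set_eqI iffI)
    fix x assume "x \<in> orbit lamplighter conj_action (lamp A m)"
    then obtain g where g: "g \<in> carrier lamplighter" "x = conj_action g (lamp A m)"
      by (auto simp: orbit_def)
    have "x \<in> carrier lamplighter" using g assms by (auto simp: lamp_in_carrier conj_action_def)
    then obtain B n where x: "x = lamp B n" "finite B" by (auto simp: carrier_lamp_iff)
    obtain T k where "g = lamp T k" "finite T" using g(1) by (auto simp: carrier_lamp_iff)
    with x g(2) eq[of T B k n] show "x \<in> lamp_class m A"
      by (auto simp: lamp_class_def conjugate_def)
  next
    fix x assume "x \<in> lamp_class m A"
    then obtain B T k where B: "x = lamp B m" "finite B" "finite T"
      "toggle T (shift k A) = toggle B (shift m T)"
      by (auto simp: lamp_class_def conjugate_def)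
    then have "conj_action (lamp T k) (lamp A m) = x" using eq[of T B k m] by simp
    then show "x \<in> orbit lamplighter conj_action (lamp A m)"
      unfolding orbit_def using B(3) lamp_in_carrier by blast
  qed
qed

lemma conjugacy_classes_lamplighter:
  "conjugacy_classes lamplighter = {lamp_class m A | m A. finite A}"
proof -
  have "conjugacy_classes lamplighter = {orbit lamplighter conj_action x | x. x \<in> carrier lamplighter}"
    by (simp add: conjugacy_classes_def orbits_def conj_action_def)
  also have "\<dots> = {lamp_class m A | m A. finite A}"
  proof (intro equalityI subsetI)
    fix C assume "C \<in> {orbit lamplighter conj_action x | x. x \<in> carrier lamplighter}"
    then obtain A m where "finite A" "C = orbit lamplighter conj_action (lamp A m)"
      unfolding carrier_lamp_iff by blast
    then show "C \<in> {lamp_class m A | m A. finite A}" using orbit_lamp by blast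
  next
    fix C assume "C \<in> {lamp_class m A | m A. finite A}"
    then obtain A m where "finite A" "C = orbit lamplighter conj_action (lamp A m)"
      using orbit_lamp by blast
    then show "C \<in> {orbit lamplighter conj_action x | x. x \<in> carrier lamplighter}"
      using lamp_in_carrier by blast
  qed
  finally show ?thesis .
qed

text \<open>
Orbits of a group action are equal or disjoint, so membership of one representative decides equality.
In particular, this spares direct proofs that \<open>conjugate\<close> is symmetric and transitive.
\<close>

lemma lamp_class_eq_iff:
  assumes "finite A" "finite B"
  shows "lamp_class m A = lamp_class n B \<longleftrightarrow> m = n \<and> conjugate m A B"
proof -
  interpret act: group_action lamplighter "carrier lamplighter" conj_action
    unfolding conj_action_def by (rule group.action_by_conjugation[OF group_lamplighter])
  have c: "lamp A m \<in> carrier lamplighter" "lamp B n \<in> carrier lamplighter"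
    using assms by (auto simp: carrier_lamp_iff)
  have self: "lamp B n \<in> lamp_class n B"
    using assms by (auto simp: lamp_class_def conjugate_refl)
  have "lamp_class m A = lamp_class n B \<longleftrightarrow> lamp B n \<in> lamp_class m A"
  proof
    assume "lamp B n \<in> lamp_class m A"
    then show "lamp_class m A = lamp_class n B"
      using act.disjoint_union[of "lamp_class m A" "lamp_class n B"] self c orbit_lamp[OF assms(1), of m]
        orbit_lamp[OF assms(2), of n]
      unfolding orbits_def by blast
  qed (use self in simp)
  also have "\<dots> \<longleftrightarrow> m = n \<and> conjugate m A B"
    using assms by (auto simp: lamp_class_def lamp_eq_iff)
  finally show ?thesis .
qed

lemma class_length_spelled:
  assumes "finite A"
  obtains B where "finite B" "conjugate m A B"
    "spells (class_length lamplighter lamplighter_gens (lamp_class m A)) B m"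
proof -
  let ?L = "word_length lamplighter lamplighter_gens ` lamp_class m A"
  have "lamp A m \<in> lamp_class m A"
    using assms by (auto simp: lamp_class_def conjugate_refl)
  then have "\<exists>n. n \<in> ?L" by blast
  from LeastI_ex[OF this] have "class_length lamplighter lamplighter_gens (lamp_class m A) \<in> ?L"
    by (simp add: class_length_def)
  then obtain B where B: "finite B" "conjugate m A B"
    "class_length lamplighter lamplighter_gens (lamp_class m A) = (LEAST n. spells n B m)"
    by (auto simp: lamp_class_def word_length_lamp)
  with LeastI_ex[OF spells_exists[OF B(1), of m]] that show thesis by simp
qed

lemma class_length_le:
  assumes "finite B" "conjugate m A B" "spells n B m"
  shows "class_length lamplighter lamplighter_gens (lamp_class m A) \<le> n"
proof -
  have "word_length lamplighter lamplighter_gens (lamp B m)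
      \<in> word_length lamplighter lamplighter_gens ` lamp_class m A"
    using assms by (auto simp: lamp_class_def)
  then have "class_length lamplighter lamplighter_gens (lamp_class m A)
      \<le> word_length lamplighter lamplighter_gens (lamp B m)"
    unfolding class_length_def by (rule Least_le)
  also have "\<dots> \<le> n"
    unfolding word_length_lamp by (rule Least_le) (rule assms(3))
  finally show ?thesis .
qed

section \<open>Rotations of a cyclic window\<close>

definition rotation :: "nat \<Rightarrow> int \<Rightarrow> int set \<Rightarrow> int set" where
  "rotation M k U = {i \<in> {0..<int M}. (i - k) mod int M \<in> U}"

lemma rotation_rotation: "rotation M a (rotation M b U) = rotation M (a + b) U"
proof -
  have "(i - a) mod int M \<in> rotation M b U \<longleftrightarrow> (i - (a + b)) mod int M \<in> U"
    if "i \<in> {0..<int M}" for i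
  proof -
    have "(i - a) mod int M \<in> {0..<int M}" using that by simp
    moreover have "((i - a) mod int M - b) mod int M = (i - (a + b)) mod int M"
      by (simp only: mod_diff_left_eq diff_diff_eq)
    ultimately show ?thesis by (simp only: rotation_def mem_Collect_eq simp_thms)
  qed
  then show ?thesis unfolding rotation_def[of M a] rotation_def[of M "a + b"] by blast
qed

lemma rotation_subset: "rotation M k U \<subseteq> {0..<int M}"
  by (auto simp: rotation_def)

lemma rotation_0: "U \<subseteq> {0..<int M} \<Longrightarrow> rotation M 0 U = U"
  by (auto simp: rotation_def)

lemma rotation_mod: "rotation M (k mod int M) U = rotation M k U"
  by (simp add: rotation_def mod_diff_right_eq)

lemma card_rotation:
  assumes "U \<subseteq> {0..<int M}"
  shows "card (rotation M k U) = card U"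
proof -
  have le: "card (rotation M k U) \<le> card U" if U: "U \<subseteq> {0..<int M}" for k U
  proof (rule card_inj_on_le)
    show "inj_on (\<lambda>i. (i - k) mod int M) (rotation M k U)"
    proof (rule inj_onI)
      fix i j assume ij: "i \<in> rotation M k U" "j \<in> rotation M k U"
        and eq: "(i - k) mod int M = (j - k) mod int M"
      from eq have "int M dvd i - j" by (simp add: mod_eq_dvd_iff)
      then have "i mod int M = j mod int M" by (simp add: mod_eq_dvd_iff)
      then show "i = j" using ij by (simp add: rotation_def)
    qed
    show "finite U" using U finite_subset by blast
  qed (auto simp: rotation_def)
  have "U = rotation M (- k) (rotation M k U)"
    using assms by (simp add: rotation_rotation rotation_0)
  then have "card U \<le> card (rotation M k U)" using le[OF rotation_subset] by metis
  with le[OF assms] show ?thesis by (rule antisym)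
qed

text \<open>
In the language of words, these are the binary words of length \<open>M\<close> that are proper powers.
\<close>

definition symmetric_windows :: "nat \<Rightarrow> int set set" where
  "symmetric_windows M = {U. U \<subseteq> {0..<int M} \<and> (\<exists>d\<in>{0<..<int M}. rotation M d U = U)}"

text \<open>
A set that is fixed by the rotation by \<open>d\<close> is periodic, hence determined by its first \<open>d\<close> positions.
\<close>

lemma card_fixed_windows:
  assumes "0 < d" "d < M"
  shows "card {U. U \<subseteq> {0..<int M} \<and> rotation M (int d) U = U} \<le> 2 ^ d"
proof -
  let ?P = "{U. U \<subseteq> {0..<int M} \<and> rotation M (int d) U = U}"
  have "card ?P \<le> card (Pow {0..<int d})"
  proof (rule card_inj_on_le)
    show "inj_on (\<lambda>U. U \<inter> {0..<int d}) ?P"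
    proof (rule inj_onI)
      fix U V assume U: "U \<in> ?P" and V: "V \<in> ?P" and eq: "U \<inter> {0..<int d} = V \<inter> {0..<int d}"
      have step: "int i \<in> W \<longleftrightarrow> int (i - d) \<in> W" if "W \<in> ?P" "d \<le> i" "i < M" for W i
      proof -
        have "int i \<in> W \<longleftrightarrow> int i \<in> rotation M (int d) W" using that(1) by simp
        also have "\<dots> \<longleftrightarrow> int (i - d) \<in> W" using that(2,3) by (simp add: rotation_def of_nat_diff)
        finally show ?thesis .
      qed
      have "i < M \<Longrightarrow> int i \<in> U \<longleftrightarrow> int i \<in> V" for i
      proof (induction i rule: less_induct)
        case (less i)
        show ?case
        proof (cases "i < d")
          case True
          then have "int i \<in> {0..<int d}" by simp
          with eq show ?thesis by blast
        next
          case False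
          then show ?thesis
            using less.IH[of "i - d"] less.prems step[OF U, of i] step[OF V, of i] assms(1) by simp
        qed
      qed
      then have "i \<in> U \<longleftrightarrow> i \<in> V" if "i \<in> {0..<int M}" for i
        using that by (metis atLeastLessThan_iff int_nat_eq nat_less_iff)
      then show "U = V" using U V by blast
    qed
  qed auto
  then show ?thesis by (simp add: card_Pow)
qed

text \<open>
If the rotation by \<open>d\<close> fixes a set, so does the rotation by \<open>M - d\<close>. One of the two is at most \<open>M / 2\<close>,
and in that range the bound for a single rotation is small.
\<close>

lemma card_symmetric_windows: "card (symmetric_windows M) \<le> 2 ^ (M div 2 + 1)"
proof -
  let ?P = "\<lambda>d. {U. U \<subseteq> {0..<int M} \<and> rotation M (int d) U = U}"
  have fin: "finite (?P d)" for d
    by (rule finite_subset[of _ "Pow {0..<int M}"]) auto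
  have "symmetric_windows M \<subseteq> (\<Union>d\<in>{1..M div 2}. ?P d)"
  proof
    fix U assume "U \<in> symmetric_windows M"
    then obtain d where U: "U \<subseteq> {0..<int M}" and d: "0 < d" "d < int M" "rotation M d U = U"
      by (auto simp: symmetric_windows_def)
    have "rotation M (- d) U = rotation M (- d) (rotation M d U)" using d(3) by simp
    also have "\<dots> = U" using U by (simp add: rotation_rotation rotation_0)
    finally have neg: "rotation M (int M - d) U = U"
      using rotation_mod[of M "int M - d" U] rotation_mod[of M "- d" U] by (simp add: mod_diff_eq)
    show "U \<in> (\<Union>d\<in>{1..M div 2}. ?P d)"
    proof (cases "2 * d \<le> int M")
      case True
      with d U show ?thesis by (intro UN_I[of "nat d"]) auto
    next
      case False
      with d U neg show ?thesis by (intro UN_I[of "nat (int M - d)"]) auto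
    qed
  qed
  then have "card (symmetric_windows M) \<le> card (\<Union>d\<in>{1..M div 2}. ?P d)"
    by (intro card_mono) (use fin in auto)
  also have "\<dots> \<le> (\<Sum>d\<in>{1..M div 2}. card (?P d))" by (rule card_UN_le) simp
  also have "\<dots> \<le> (\<Sum>d\<in>{1..M div 2}. 2 ^ d)"
    by (intro sum_mono card_fixed_windows) auto
  also have "\<dots> \<le> (\<Sum>d\<in>{0..<M div 2 + 1}. 2 ^ d)"
    by (intro sum_mono2) auto
  also have "\<dots> \<le> 2 ^ (M div 2 + 1)" by (simp add: sum_power2)
  finally show ?thesis .
qed

text \<open>
Counting an image through the fibres: every fibre has at most \<open>M\<close> elements, and those that avoid the
exceptional set \<open>P\<close> have at least \<open>M\<close>. The exceptional elements contribute at most one image point each.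
\<close>

lemma card_image_bounds:
  assumes "finite S" "finite P"
    and le: "\<And>x. x \<in> S \<Longrightarrow> card {y \<in> S. f y = f x} \<le> M"
    and ge: "\<And>x. x \<in> S - P \<Longrightarrow> M \<le> card {y \<in> S. f y = f x}"
  shows "card S \<le> M * card (f ` S)" "M * card (f ` S) \<le> card S + M * card P"
proof -
  let ?F = "\<lambda>z. {y \<in> S. f y = z}"
  have S: "card S = (\<Sum>z\<in>f ` S. card (?F z))"
    using sum.group[of S "f ` S" f "\<lambda>_. 1::nat"] assms(1) by simp
  also have "\<dots> \<le> (\<Sum>z\<in>f ` S. M)" by (intro sum_mono) (use le in auto)
  finally show "card S \<le> M * card (f ` S)" by (simp add: mult.commute)
  let ?Y = "f ` S - f ` P"
  have "card (f ` S) \<le> card (?Y \<union> f ` P)" by (intro card_mono) (use assms in auto)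
  also have "\<dots> \<le> card ?Y + card (f ` P)" by (rule card_Un_le)
  also have "\<dots> \<le> card ?Y + card P" using card_image_le[OF assms(2)] by simp
  finally have "M * card (f ` S) \<le> M * card ?Y + M * card P"
    by (metis add_mult_distrib2 mult_le_mono2)
  also have "M * card ?Y = (\<Sum>z\<in>?Y. M)" by simp
  also have "\<dots> \<le> (\<Sum>z\<in>?Y. card (?F z))" by (intro sum_mono) (use ge in auto)
  also have "\<dots> \<le> card S" unfolding S by (intro sum_mono2) (use assms in auto)
  finally show "M * card (f ` S) \<le> card S + M * card P" by simp
qed

text \<open>
Here \<open>f\<close> is any complete invariant of subsets of the window up to rotation, so \<open>N k\<close> is the number of
binary necklaces with \<open>M\<close> beads of which \<open>k\<close> are black. The fibre of \<open>U\<close> consists of the rotations of \<open>U\<close>, and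
these are pairwise different unless \<open>U\<close> has a rotational symmetry.
\<close>

lemma card_rotation_classes:
  fixes f :: "int set \<Rightarrow> 'c"
  assumes M: "M > 0"
    and f: "\<And>U V. U \<subseteq> {0..<int M} \<Longrightarrow> V \<subseteq> {0..<int M} \<Longrightarrow> f U = f V \<longleftrightarrow> (\<exists>k. V = rotation M k U)"
  defines "N \<equiv> \<lambda>k. card (f ` {U. U \<subseteq> {0..<int M} \<and> card U = k})"
  shows "real (M choose k) / M \<le> N k" "N k \<le> real (M choose k) / M + 2 ^ (M div 2 + 1)"
proof -
  let ?S = "{U. U \<subseteq> {0..<int M} \<and> card U = k}"
  have finP: "finite (symmetric_windows M)"
    by (rule finite_subset[of _ "Pow {0..<int M}"]) (auto simp: symmetric_windows_def)
  have finS: "finite ?S" by (rule finite_subset[of _ "Pow {0..<int M}"]) auto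
  have fibre: "{V \<in> ?S. f V = f U} = (\<lambda>j. rotation M j U) ` {0..<int M}" if U: "U \<in> ?S" for U
  proof
    show "{V \<in> ?S. f V = f U} \<subseteq> (\<lambda>j. rotation M j U) ` {0..<int M}"
    proof
      fix V assume V: "V \<in> {V \<in> ?S. f V = f U}"
      then obtain j where "V = rotation M j U" using f[of U V] U by auto
      then have "V = rotation M (j mod int M) U" by (simp add: rotation_mod)
      moreover have "j mod int M \<in> {0..<int M}" using M by simp
      ultimately show "V \<in> (\<lambda>j. rotation M j U) ` {0..<int M}" by blast
    qed
    show "(\<lambda>j. rotation M j U) ` {0..<int M} \<subseteq> {V \<in> ?S. f V = f U}"
    proof
      fix V assume "V \<in> (\<lambda>j. rotation M j U) ` {0..<int M}"
      then obtain j where V: "V = rotation M j U" by blast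
      then show "V \<in> {V \<in> ?S. f V = f U}"
        using f[of U V] U rotation_subset[of M j U] card_rotation[of U M j] by auto
    qed
  qed
  have le: "card {V \<in> ?S. f V = f U} \<le> M" if "U \<in> ?S" for U
    unfolding fibre[OF that] using card_image_le[of "{0..<int M}" "\<lambda>j. rotation M j U"] by simp
  have ge: "M \<le> card {V \<in> ?S. f V = f U}" if U: "U \<in> ?S - symmetric_windows M" for U
  proof -
    have no: False if "a < b" "a \<in> {0..<int M}" "b \<in> {0..<int M}" "rotation M a U = rotation M b U" for a b
    proof -
      have "rotation M (b - a) U = rotation M (- a) (rotation M a U)"
        using that(4) by (simp add: rotation_rotation)
      also have "\<dots> = U" using U by (simp add: rotation_rotation rotation_0)
      finally show False using U that by (auto simp: symmetric_windows_def)
    qed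
    have "inj_on (\<lambda>j. rotation M j U) {0..<int M}"
    proof (rule inj_onI)
      fix a b assume "a \<in> {0..<int M}" "b \<in> {0..<int M}" "rotation M a U = rotation M b U"
      then show "a = b" using no[of a b] no[of b a] by (cases a b rule: linorder_cases) auto
    qed
    moreover have "U \<in> ?S" using U by blast
    ultimately show ?thesis unfolding fibre[OF \<open>U \<in> ?S\<close>] by (simp add: card_image)
  qed
  have S: "card ?S = M choose k" using n_subsets[of "{0..<int M}" k] by simp
  have "card ?S \<le> M * N k" "M * N k \<le> card ?S + M * card (symmetric_windows M)"
    using card_image_bounds[OF finS finP le ge] by (simp_all add: N_def)
  moreover have "M * card (symmetric_windows M) \<le> M * 2 ^ (M div 2 + 1)"
    using card_symmetric_windows by (rule mult_le_mono2)
  ultimately have "M choose k \<le> M * N k" "M * N k \<le> (M choose k) + M * 2 ^ (M div 2 + 1)"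
    unfolding S by linarith+
  then have "real (M choose k) \<le> real (M * N k)"
    "real (M * N k) \<le> real ((M choose k) + M * 2 ^ (M div 2 + 1))"
    by (simp_all only: of_nat_le_iff)
  then show "real (M choose k) / M \<le> N k" "N k \<le> real (M choose k) / M + 2 ^ (M div 2 + 1)"
    using M by (simp_all add: field_simps)
qed

section \<open>Conjugacy with nonzero translation\<close>

text \<open>
The class invariant: reducing a configuration modulo \<open>m\<close> gives an element of a direct sum of copies of
\<open>C\<^sub>2\<close> indexed by the residues. It is represented here by an \<open>m\<close>-periodic set of integers, on which
translations act without any reduction.
\<close>

definition parity_set :: "int \<Rightarrow> int set \<Rightarrow> int set" where
  "parity_set m A = {i. odd (card {j \<in> A. m dvd j - i})}"

lemma odd_card_toggle:
  assumes "finite A" "finite B"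
  shows "odd (card (toggle A B)) \<longleftrightarrow> odd (card A) \<noteq> odd (card B)"
proof -
  have "toggle A B = (A - B) \<union> (B - A)" by (auto simp: toggle_def)
  moreover have "card ((A - B) \<union> (B - A)) = card (A - B) + card (B - A)"
    using assms by (intro card_Un_disjoint) auto
  ultimately have "card (toggle A B) = card (A - B) + card (B - A)" by simp
  moreover have "card (A \<inter> B) + card (A - B) = card A"
    using assms(1) by (rule card_Int_Diff[symmetric])
  moreover have "card (A \<inter> B) + card (B - A) = card B"
    using card_Int_Diff[OF assms(2), of A] by (simp add: Int_commute)
  ultimately show ?thesis by presburger
qed

lemma parity_set_toggle:
  assumes "finite A" "finite B"
  shows "parity_set m (toggle A B) = toggle (parity_set m A) (parity_set m B)"
proof -
  have "odd (card {j \<in> toggle A B. m dvd j - i}) \<longleftrightarrow>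
      odd (card {j \<in> A. m dvd j - i}) \<noteq> odd (card {j \<in> B. m dvd j - i})" for i
  proof -
    have "{j \<in> toggle A B. m dvd j - i} = toggle {j \<in> A. m dvd j - i} {j \<in> B. m dvd j - i}"
      by (auto simp: toggle_def)
    then show ?thesis using odd_card_toggle assms by simp
  qed
  then show ?thesis by (simp add: parity_set_def toggle_def)
qed

lemma parity_set_shift: "parity_set m (shift k A) = shift k (parity_set m A)"
proof -
  have "{j \<in> shift k A. m dvd j - i} = shift k {j \<in> A. m dvd j - (i - k)}" for i
    by (auto simp: shift_def algebra_simps)
  then show ?thesis by (simp add: parity_set_def card_shift) (simp add: shift_def)
qed

lemma parity_set_cong: "m dvd i - i' \<Longrightarrow> i \<in> parity_set m A \<longleftrightarrow> i' \<in> parity_set m A"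
proof -
  assume d: "m dvd i - i'"
  have "m dvd j - i \<longleftrightarrow> m dvd j - i'" for j
    using dvd_add_right_iff[OF d, of "j - i"] by simp
  then show ?thesis by (simp add: parity_set_def)
qed

lemma parity_set_periodic: "shift m (parity_set m A) = parity_set m A"
proof -
  have "i - m \<in> parity_set m A \<longleftrightarrow> i \<in> parity_set m A" for i
    by (rule parity_set_cong) simp
  then show ?thesis by (simp add: shift_def)
qed

lemma mem_parity_set_mod: "i \<in> parity_set m A \<longleftrightarrow> i mod \<bar>m\<bar> \<in> parity_set m A"
proof (rule parity_set_cong)
  have "\<bar>m\<bar> dvd i - i mod \<bar>m\<bar>" by (rule dvd_minus_mod)
  then show "m dvd i - i mod \<bar>m\<bar>" by (simp only: abs_dvd_iff)
qed

lemma parity_set_window: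
  assumes "m \<noteq> 0" "U \<subseteq> {0..<\<bar>m\<bar>}"
  shows "parity_set m U = {i. i mod \<bar>m\<bar> \<in> U}"
proof -
  have "{j \<in> U. m dvd j - i} = {j. j = i mod \<bar>m\<bar> \<and> j \<in> U}" for i
  proof -
    have "m dvd j - i \<longleftrightarrow> j = i mod \<bar>m\<bar>" if "j \<in> U" for j
    proof -
      have "m dvd j - i \<longleftrightarrow> j mod \<bar>m\<bar> = i mod \<bar>m\<bar>"
        by (metis abs_dvd_iff mod_eq_dvd_iff)
      moreover have "j mod \<bar>m\<bar> = j" using that assms(2) by auto
      ultimately show ?thesis by simp
    qed
    then show ?thesis by auto
  qed
  then show ?thesis
    by (simp add: parity_set_def Collect_conv_if)
qed

text \<open>
Over the two-element field, this solves \<open>C = T + shift m T\<close> for finite \<open>T\<close>. The solution sums \<open>C\<close> along each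
residue class from the left; it has finite support because the total sum along each class is zero.
\<close>

lemma finite_coboundary_pos:
  assumes "m > 0" "finite C" "parity_set m C = {}"
  shows "\<exists>T. finite T \<and> C = toggle T (shift m T)"
proof (cases "C = {}")
  case True
  then show ?thesis by (intro exI[of _ "{}"]) (auto simp: toggle_def shift_def)
next
  case False
  let ?S = "\<lambda>i. {j \<in> C. m dvd j - i \<and> j \<le> i}"
  define T where "T = {i. odd (card (?S i))}"
  have "T \<subseteq> {Min C..Max C}"
  proof
    fix i assume i: "i \<in> T"
    then have "?S i \<noteq> {}" unfolding T_def by (metis (no_types, lifting) card.empty even_zero mem_Collect_eq)
    then have "Min C \<le> i" using assms(2) Min_le order_trans by blast
    moreover have "i \<le> Max C"
    proof (rule ccontr)
      assume "\<not> i \<le> Max C"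
      then have "j \<le> i" if "j \<in> C" for j using Max_ge[OF assms(2) that] by linarith
      then have "?S i = {j \<in> C. m dvd j - i}" by auto
      then have "i \<in> parity_set m C" using i unfolding T_def parity_set_def by simp
      then show False using assms(3) by simp
    qed
    ultimately show "i \<in> {Min C..Max C}" by simp
  qed
  then have "finite T" by (rule finite_subset) simp
  moreover have "i \<in> C \<longleftrightarrow> i \<in> toggle T (shift m T)" for i
  proof -
    have d: "m dvd j - (i - m) \<longleftrightarrow> m dvd j - i" for j
      by (metis diff_diff_eq2 dvd_add_left_iff dvd_refl add_diff_eq diff_add_eq)
    have le: "j \<le> i - m \<longleftrightarrow> j \<le> i \<and> j \<noteq> i" if "m dvd j - i" for j
    proof -
      from that obtain q where q: "j - i = m * q" by blast
      show ?thesis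
      proof
        assume "j \<le> i - m" then show "j \<le> i \<and> j \<noteq> i" using assms(1) by linarith
      next
        assume "j \<le> i \<and> j \<noteq> i"
        then have "m * q < 0" using q by linarith
        then have "q \<le> -1" using assms(1) by (simp add: mult_less_0_iff)
        then have "m * q \<le> m * (-1)" using assms(1) by (intro mult_left_mono) auto
        then show "j \<le> i - m" using q by linarith
      qed
    qed
    \<comment> \<open>Passing from \<open>i - m\<close> to \<open>i\<close> adds exactly the summand at \<open>i\<close> itself.\<close>
    have fS: "finite (?S k)" for k using assms(2) by simp
    have S: "?S (i - m) = ?S i - {i}"
      using le unfolding d by auto
    have "i \<in> C \<longleftrightarrow> odd (card (?S i)) \<noteq> odd (card (?S (i - m)))"
    proof (cases "i \<in> C")
      case True
      then have "card (?S i) = Suc (card (?S (i - m)))"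
        unfolding S by (intro card.remove[OF fS]) simp
      with True show ?thesis by simp
    next
      case False
      then have "?S (i - m) = ?S i" unfolding S by auto
      with False show ?thesis by simp
    qed
    then show ?thesis by (simp add: T_def toggle_def shift_def)
  qed
  ultimately show ?thesis by (intro exI[of _ T]) (auto simp only:)
qed

text \<open>
For negative \<open>m\<close>, a solution \<open>T\<close> for \<open>- m\<close> becomes a solution for \<open>m\<close> after translation by \<open>- m\<close>.
\<close>

lemma finite_coboundary:
  assumes "m \<noteq> 0" "finite C" "parity_set m C = {}"
  shows "\<exists>T. finite T \<and> C = toggle T (shift m T)"
proof (cases "m > 0")
  case True
  then show ?thesis using finite_coboundary_pos assms by blast
next
  case False
  have "parity_set (- m) C = {}" using assms(3) by (simp add: parity_set_def)
  then obtain T where T: "finite T" "C = toggle T (shift (- m) T)"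
    using finite_coboundary_pos[of "- m" C] False assms by auto
  then have "C = toggle (shift (- m) T) (shift m (shift (- m) T))"
    by (auto simp: toggle_def shift_def)
  then show ?thesis using finite_shift[OF T(1)] by blast
qed

text \<open>
The parity set is additive, and \<open>T\<close> and \<open>shift m T\<close> have the same one, so they cancel in the conjugacy
equation. The converse is the solvability of the coboundary equation.
\<close>

lemma conjugate_iff_parity_set:
  assumes "m \<noteq> 0" "finite A" "finite B"
  shows "conjugate m A B \<longleftrightarrow> (\<exists>k. parity_set m B = shift k (parity_set m A))"
proof
  assume "conjugate m A B"
  then obtain T k where T: "finite T" and eq: "toggle T (shift k A) = toggle B (shift m T)"
    by (auto simp: conjugate_def)
  have "parity_set m (toggle T (shift k A)) = toggle (parity_set m T) (shift k (parity_set m A))"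
    using T assms by (simp add: parity_set_toggle parity_set_shift finite_shift)
  moreover have "parity_set m (toggle B (shift m T)) = toggle (parity_set m B) (parity_set m T)"
    using T assms by (simp add: parity_set_toggle parity_set_shift parity_set_periodic finite_shift)
  ultimately have "toggle (parity_set m T) (shift k (parity_set m A)) = toggle (parity_set m B) (parity_set m T)"
    using eq by simp
  then have "parity_set m B = shift k (parity_set m A)" by (auto simp: toggle_def set_eq_iff)
  then show "\<exists>k. parity_set m B = shift k (parity_set m A)" ..
next
  assume "\<exists>k. parity_set m B = shift k (parity_set m A)"
  then obtain k where k: "parity_set m B = shift k (parity_set m A)" ..
  have "parity_set m (toggle (shift k A) B) = {}"
    using assms by (simp add: parity_set_toggle parity_set_shift finite_shift k) (simp add: toggle_def)
  then obtain T where T: "finite T" "toggle (shift k A) B = toggle T (shift m T)"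
    using finite_coboundary[of m "toggle (shift k A) B"] assms by (auto simp: finite_toggle finite_shift)
  then have "toggle T (shift k A) = toggle B (shift m T)" by (auto simp: toggle_def set_eq_iff)
  with T(1) show "conjugate m A B" by (auto simp: conjugate_def)
qed

lemma conjugate_window:
  assumes "m \<noteq> 0" "finite A"
  obtains U where "U \<subseteq> {0..<\<bar>m\<bar>}" "conjugate m A U"
proof
  let ?U = "parity_set m A \<inter> {0..<\<bar>m\<bar>}"
  show sub: "?U \<subseteq> {0..<\<bar>m\<bar>}" by simp
  then have fin: "finite ?U" by (rule finite_subset) simp
  have "parity_set m ?U = {i. i mod \<bar>m\<bar> \<in> ?U}" by (rule parity_set_window[OF assms(1) sub])
  also have "\<dots> = {i. i mod \<bar>m\<bar> \<in> parity_set m A}" using assms(1) by auto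
  also have "\<dots> = parity_set m A" using mem_parity_set_mod by blast
  finally have "parity_set m ?U = shift 0 (parity_set m A)" by (simp add: shift_0)
  then show "conjugate m A ?U"
    using conjugate_iff_parity_set[OF assms fin] by blast
qed

lemma conjugate_window_iff:
  assumes "m \<noteq> 0" "U \<subseteq> {0..<\<bar>m\<bar>}" "V \<subseteq> {0..<\<bar>m\<bar>}"
  shows "conjugate m U V \<longleftrightarrow> (\<exists>k. V = rotation (nat \<bar>m\<bar>) k U)"
proof -
  have fin: "finite U" "finite V" using assms(2,3) by (auto intro: finite_subset)
  have "parity_set m V = shift k (parity_set m U) \<longleftrightarrow> V = rotation (nat \<bar>m\<bar>) k U" for k
  proof -
    have "parity_set m V = shift k (parity_set m U) \<longleftrightarrow>
        (\<forall>i. i mod \<bar>m\<bar> \<in> V \<longleftrightarrow> (i - k) mod \<bar>m\<bar> \<in> U)"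
      by (simp add: parity_set_window assms shift_def set_eq_iff)
    also have "\<dots> \<longleftrightarrow> (\<forall>i\<in>{0..<\<bar>m\<bar>}. i \<in> V \<longleftrightarrow> (i - k) mod \<bar>m\<bar> \<in> U)" (is "?P \<longleftrightarrow> ?Q")
    proof
      assume ?P
      show ?Q
      proof
        fix i assume "i \<in> {0..<\<bar>m\<bar>}"
        then have "i mod \<bar>m\<bar> = i" by simp
        with \<open>?P\<close> show "i \<in> V \<longleftrightarrow> (i - k) mod \<bar>m\<bar> \<in> U" by metis
      qed
    next
      assume ?Q
      show ?P
      proof
        fix i
        have "i mod \<bar>m\<bar> \<in> {0..<\<bar>m\<bar>}" using assms(1) by simp
        with \<open>?Q\<close> have "i mod \<bar>m\<bar> \<in> V \<longleftrightarrow> (i mod \<bar>m\<bar> - k) mod \<bar>m\<bar> \<in> U" by blast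
        then show "i mod \<bar>m\<bar> \<in> V \<longleftrightarrow> (i - k) mod \<bar>m\<bar> \<in> U" by (simp add: mod_diff_left_eq)
      qed
    qed
    also have "\<dots> \<longleftrightarrow> V = rotation (nat \<bar>m\<bar>) k U"
    proof -
      have "rotation (nat \<bar>m\<bar>) k U = {i \<in> {0..<\<bar>m\<bar>}. (i - k) mod \<bar>m\<bar> \<in> U}"
        by (simp only: rotation_def int_nat_eq abs_ge_zero if_True)
      then show ?thesis using assms(3) by blast
    qed
    finally show ?thesis .
  qed
  then show ?thesis using conjugate_iff_parity_set[OF assms(1) fin] by simp
qed

text \<open>
A configuration in the window has the fewest lit lamps in its class: in any conjugate, each of its
lamps corresponds to a residue class with an odd number of lit lamps, hence with at least one.
\<close>

lemma card_le_conjugate: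
  assumes "m \<noteq> 0" "U \<subseteq> {0..<\<bar>m\<bar>}" "finite B" "conjugate m U B"
  shows "card U \<le> card B"
proof -
  have "finite U" using assms(2) by (rule finite_subset) simp
  then obtain k where k: "parity_set m B = shift k (parity_set m U)"
    using conjugate_iff_parity_set assms by blast
  have "U \<subseteq> (\<lambda>j. (j - k) mod \<bar>m\<bar>) ` B"
  proof
    fix u assume u: "u \<in> U"
    then have um: "u mod \<bar>m\<bar> = u" using assms(2) by auto
    with u have "u + k \<in> parity_set m B"
      by (simp add: k shift_def parity_set_window assms)
    then have "{j \<in> B. m dvd j - (u + k)} \<noteq> {}"
      by (auto simp only: parity_set_def mem_Collect_eq card.empty even_zero)
    then obtain j where j: "j \<in> B" "m dvd j - (u + k)" by blast
    then have "\<bar>m\<bar> dvd (j - k) - u" by (simp add: diff_diff_eq add.commute)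
    then have "(j - k) mod \<bar>m\<bar> = u mod \<bar>m\<bar>" by (simp add: mod_eq_dvd_iff)
    with um j(1) show "u \<in> (\<lambda>j. (j - k) mod \<bar>m\<bar>) ` B" by force
  qed
  then show ?thesis using assms(3) surj_card_le by blast
qed

section \<open>Lengths of the classes with nonzero translation\<close>

lemma spells_lower: "spells n A m \<Longrightarrow> finite A \<and> nat \<bar>m\<bar> + card A \<le> n"
proof (induction rule: spells.induct)
  case (switch n A m)
  have "toggle {0} A \<subseteq> insert 0 A" by (auto simp: toggle_def)
  then have "card (toggle {0} A) \<le> card (insert 0 A)" using switch by (intro card_mono) auto
  also have "\<dots> \<le> Suc (card A)" using switch by (simp add: card_insert_if)
  finally show ?case using switch by (simp add: finite_toggle)
qed (auto simp: finite_shift card_shift)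

lemma switch_if_needed:
  assumes "spells n (U - {0}) m" "finite U"
  shows "spells (n + (card U - card (U - {0}))) U m"
proof (cases "0 \<in> U")
  case True
  then have "toggle {0} (U - {0}) = U" by (auto simp: toggle_def)
  moreover have "card U = Suc (card (U - {0}))" using True assms(2) by (rule card.remove[rotated])
  ultimately show ?thesis using spells.switch[OF assms(1)] by simp
qed (use assms in simp)

text \<open>
The lamplighter walks from \<open>0\<close> to \<open>M\<close> and switches lamps on the way. In the induction the first letters of
the word deal with position \<open>0\<close>, and the rest of the word with the translated remaining window.
\<close>

lemma spells_right:
  "U \<subseteq> {0..<int M} \<Longrightarrow> spells (M + card U) U (int M)"
proof (induction M arbitrary: U)
  case 0
  then show ?case using spells.empty by simp
next
  case (Suc M)
  let ?A = "shift (-1) (U - {0})"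
  have fin: "finite U" using Suc.prems by (rule finite_subset) simp
  have "?A \<subseteq> {0..<int M}" using Suc.prems by (auto simp: shift_def)
  from spells.right[OF Suc.IH[OF this]]
  have "spells (Suc (M + card (U - {0}))) (shift 1 ?A) (int (Suc M))" by (simp add: card_shift add.commute)
  also have "shift 1 ?A = U - {0}" by (auto simp: shift_def)
  finally have "spells (Suc (M + card (U - {0})) + (card U - card (U - {0}))) U (int (Suc M))"
    using switch_if_needed fin by blast
  moreover have "card (U - {0}) \<le> card U" using fin by (simp add: card_mono)
  ultimately show ?case by simp
qed

text \<open>
The walk to the left steps before it switches, so it serves the window that excludes \<open>0\<close>. This does not
matter for conjugacy classes, which are invariant under translation.
\<close>

lemma spells_left:
  "U \<subseteq> {- int M..<0} \<Longrightarrow> spells (M + card U) U (- int M)"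
proof (induction M arbitrary: U)
  case 0
  then show ?case using spells.empty by simp
next
  case (Suc M)
  let ?A = "shift 1 U"
  have fin: "finite ?A" using finite_subset[OF Suc.prems] by (intro finite_shift) simp
  have "?A - {0} \<subseteq> {- int M..<0}" using Suc.prems by (force simp: shift_def)
  then have "spells (M + card (?A - {0}) + (card ?A - card (?A - {0}))) ?A (- int M)"
    using switch_if_needed Suc.IH fin by blast
  moreover have "card (?A - {0}) \<le> card ?A" using fin by (simp add: card_mono)
  ultimately have "spells (M + card U) ?A (- int M)" by (simp add: card_shift)
  moreover have "shift (-1) ?A = U" "- int M - 1 = - int (Suc M)" by (simp_all add: shift_def)
  ultimately show ?case using spells.left[of "M + card U" ?A "- int M"] by (simp only: add_Suc)
qed

lemma class_length_window:
  assumes "m \<noteq> 0" "U \<subseteq> {0..<\<bar>m\<bar>}"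
  shows "class_length lamplighter lamplighter_gens (lamp_class m U) = nat \<bar>m\<bar> + card U"
proof (rule antisym)
  have fin: "finite U" using assms(2) by (rule finite_subset) simp
  show "class_length lamplighter lamplighter_gens (lamp_class m U) \<le> nat \<bar>m\<bar> + card U"
  proof (cases "m > 0")
    case True
    then show ?thesis
      using class_length_le[OF fin conjugate_refl] spells_right[of U "nat m"] assms by simp
  next
    case False
    \<comment> \<open>The translate of \<open>U\<close> by \<open>m\<close> lies in the window served by the walk to the left.\<close>
    have "shift m U \<subseteq> {m..<0}" using assms False by (force simp: shift_def)
    then show ?thesis
      using class_length_le[OF finite_shift[OF fin] conjugate_shift] spells_left[of "shift m U" "nat (- m)"]
        assms False by (simp add: card_shift)
  qed
  obtain B where B: "finite B" "conjugate m U B"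
    "spells (class_length lamplighter lamplighter_gens (lamp_class m U)) B m"
    using class_length_spelled[OF fin] .
  have "nat \<bar>m\<bar> + card U \<le> nat \<bar>m\<bar> + card B"
    using card_le_conjugate[OF assms B(1,2)] by simp
  also have "\<dots> \<le> class_length lamplighter lamplighter_gens (lamp_class m U)"
    using spells_lower[OF B(3)] by simp
  finally show "nat \<bar>m\<bar> + card U \<le> class_length lamplighter lamplighter_gens (lamp_class m U)" .
qed

section \<open>Classes with zero translation\<close>

lemma le_step:
  fixes a b c d b' e n :: int
  assumes "a + b + c \<le> n \<or> d + b' + e \<le> n" "a' \<le> a + 1" "d' \<le> d + 1"
  shows "a' + b + c \<le> n + 1 \<or> d' + b' + e \<le> n + 1"
  using assms by linarith

text \<open>
A walk from \<open>0\<close> to \<open>m\<close> that visits both \<open>i\<close> and \<open>j\<close> visits one of them first; the two alternatives bound its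
length in either case. For \<open>m = 0\<close> both are at least \<open>2 * \<bar>j - i\<bar>\<close>.
\<close>

lemma spells_diameter:
  "spells n A m \<Longrightarrow> \<bar>m\<bar> \<le> int n \<and>
    (\<forall>i\<in>A. \<forall>j\<in>A. \<bar>i\<bar> + \<bar>j - i\<bar> + \<bar>m - j\<bar> \<le> int n \<or> \<bar>j\<bar> + \<bar>i - j\<bar> + \<bar>m - i\<bar> \<le> int n)"
proof (induction rule: spells.induct)
  case empty
  then show ?case by simp
next
  case (right n A m)
  have "\<bar>i\<bar> + \<bar>j - i\<bar> + \<bar>m + 1 - j\<bar> \<le> int (Suc n) \<or> \<bar>j\<bar> + \<bar>i - j\<bar> + \<bar>m + 1 - i\<bar> \<le> int (Suc n)"
    if "i \<in> shift 1 A" "j \<in> shift 1 A" for i j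
  proof -
    have "i - 1 \<in> A" "j - 1 \<in> A" using that by (auto simp: shift_def)
    with right.IH have "\<bar>i - 1\<bar> + \<bar>(j - 1) - (i - 1)\<bar> + \<bar>m - (j - 1)\<bar> \<le> int n \<or>
      \<bar>j - 1\<bar> + \<bar>(i - 1) - (j - 1)\<bar> + \<bar>m - (i - 1)\<bar> \<le> int n" by blast
    moreover have "(j - 1) - (i - 1) = j - i" "(i - 1) - (j - 1) = i - j"
      "m - (j - 1) = m + 1 - j" "m - (i - 1) = m + 1 - i" "int (Suc n) = int n + 1" by simp_all
    moreover have "\<bar>i\<bar> \<le> \<bar>i - 1\<bar> + 1" "\<bar>j\<bar> \<le> \<bar>j - 1\<bar> + 1" by linarith+
    ultimately show ?thesis using le_step by (simp only:)
  qed
  moreover have "\<bar>m + 1\<bar> \<le> int (Suc n)" using conjunct1[OF right.IH] by simp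
  ultimately show ?case by blast
next
  case (left n A m)
  have "\<bar>i\<bar> + \<bar>j - i\<bar> + \<bar>m - 1 - j\<bar> \<le> int (Suc n) \<or> \<bar>j\<bar> + \<bar>i - j\<bar> + \<bar>m - 1 - i\<bar> \<le> int (Suc n)"
    if "i \<in> shift (-1) A" "j \<in> shift (-1) A" for i j
  proof -
    have "i + 1 \<in> A" "j + 1 \<in> A" using that by (auto simp: shift_def)
    with left.IH have "\<bar>i + 1\<bar> + \<bar>(j + 1) - (i + 1)\<bar> + \<bar>m - (j + 1)\<bar> \<le> int n \<or>
      \<bar>j + 1\<bar> + \<bar>(i + 1) - (j + 1)\<bar> + \<bar>m - (i + 1)\<bar> \<le> int n" by blast
    moreover have "(j + 1) - (i + 1) = j - i" "(i + 1) - (j + 1) = i - j"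
      "m - (j + 1) = m - 1 - j" "m - (i + 1) = m - 1 - i" "int (Suc n) = int n + 1" by simp_all
    moreover have "\<bar>i\<bar> \<le> \<bar>i + 1\<bar> + 1" "\<bar>j\<bar> \<le> \<bar>j + 1\<bar> + 1" by linarith+
    ultimately show ?thesis using le_step by (simp only:)
  qed
  moreover have "\<bar>m - 1\<bar> \<le> int (Suc n)" using conjunct1[OF left.IH] by simp
  ultimately show ?case by blast
next
  case (switch n A m)
  have one: "\<bar>i\<bar> + \<bar>m - i\<bar> \<le> int n" if "i \<in> A" for i
  proof -
    from switch.IH that have "\<bar>i\<bar> + \<bar>i - i\<bar> + \<bar>m - i\<bar> \<le> int n" by blast
    then show ?thesis by simp
  qed
  have "\<bar>i\<bar> + \<bar>j - i\<bar> + \<bar>m - j\<bar> \<le> int (Suc n) \<or> \<bar>j\<bar> + \<bar>i - j\<bar> + \<bar>m - i\<bar> \<le> int (Suc n)"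
    if "i \<in> insert 0 A" "j \<in> insert 0 A" for i j
  proof (cases "i = 0 \<or> j = 0")
    case True
    then show ?thesis
    proof
      assume "i = 0"
      then show ?thesis using that(2) one[of j] switch.IH by (cases "j = 0") simp_all
    next
      assume "j = 0"
      then show ?thesis using that(1) one[of i] switch.IH by (cases "i = 0") simp_all
    qed
  next
    case False
    then have "i \<in> A" "j \<in> A" using that by auto
    with switch.IH have "\<bar>i\<bar> + \<bar>j - i\<bar> + \<bar>m - j\<bar> \<le> int n \<or> \<bar>j\<bar> + \<bar>i - j\<bar> + \<bar>m - i\<bar> \<le> int n" by blast
    moreover have "int n \<le> int (Suc n)" by simp
    ultimately show ?thesis using order_trans by blast
  qed
  moreover have "toggle {0} A \<subseteq> insert 0 A" by (auto simp: toggle_def)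
  ultimately show ?case using switch.IH by (simp add: subset_iff)
qed

text \<open>
After translation, the lamps of a shortest representative lie in \<open>{0..n div 2}\<close>.
\<close>

lemma card_torsion_classes:
  "card {C \<in> conjugacy_classes lamplighter. class_length lamplighter lamplighter_gens C = n
      \<and> (\<exists>A. finite A \<and> C = lamp_class 0 A)} \<le> 2 ^ (n div 2 + 1)" (is "card ?Z \<le> _")
proof -
  let ?W = "{0..int (n div 2)}"
  have "?Z \<subseteq> lamp_class 0 ` Pow ?W"
  proof
    fix C assume "C \<in> ?Z"
    then obtain A where A: "finite A" "C = lamp_class 0 A"
      and n: "class_length lamplighter lamplighter_gens C = n" by blast
    obtain B where B: "finite B" "conjugate 0 A B" "spells n B 0"
      using class_length_spelled[OF A(1), of 0] A(2) n by metis
    let ?D = "shift (- Min B) B"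
    have C: "C = lamp_class 0 ?D"
      using lamp_class_eq_iff[OF A(1) B(1), of 0 0] lamp_class_eq_iff[OF B(1) finite_shift[OF B(1)], of 0 0]
        conjugate_shift[of 0 B] B(2) A(2) by simp
    have "?D \<subseteq> ?W"
    proof
      fix i assume "i \<in> ?D"
      then have i: "i + Min B \<in> B" by (simp add: shift_def)
      have "Min B \<in> B" using B(1) i by (intro Min_in) blast+
      moreover have "Min B \<le> i + Min B" using B(1) i by (rule Min_le)
      ultimately have "0 \<le> i" "Min B \<in> B" by simp_all
      have "\<bar>i + Min B\<bar> + \<bar>Min B - (i + Min B)\<bar> + \<bar>0 - Min B\<bar> \<le> int n \<or>
          \<bar>Min B\<bar> + \<bar>i + Min B - Min B\<bar> + \<bar>0 - (i + Min B)\<bar> \<le> int n"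
        using spells_diameter[OF B(3)] i \<open>Min B \<in> B\<close> by blast
      then have "2 * i \<le> int n" using \<open>0 \<le> i\<close> by linarith
      with \<open>0 \<le> i\<close> show "i \<in> ?W" by simp
    qed
    with C show "C \<in> lamp_class 0 ` Pow ?W" by blast
  qed
  then have "card ?Z \<le> card (lamp_class 0 ` Pow ?W)" by (intro card_mono) simp_all
  also have "\<dots> \<le> card (Pow ?W)" by (rule card_image_le) simp
  also have "\<dots> = 2 ^ (n div 2 + 1)" by (simp add: card_Pow nat_add_distrib)
  finally show ?thesis .
qed

section \<open>Counting the classes of a given length\<close>

definition window_classes :: "int \<Rightarrow> nat \<Rightarrow> ((int \<Rightarrow> int) \<times> int) set set" where
  "window_classes m k = lamp_class m ` {U. U \<subseteq> {0..<\<bar>m\<bar>} \<and> card U = k}"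

lemma finite_window_classes: "finite (window_classes m k)"
  unfolding window_classes_def
  by (rule finite_imageI, rule finite_subset[of _ "Pow {0..<\<bar>m\<bar>}"]) auto

lemma card_window_classes:
  assumes "m \<noteq> 0"
  shows "real (nat \<bar>m\<bar> choose k) / nat \<bar>m\<bar> \<le> card (window_classes m k)"
    "card (window_classes m k) \<le> real (nat \<bar>m\<bar> choose k) / nat \<bar>m\<bar> + 2 ^ (nat \<bar>m\<bar> div 2 + 1)"
proof -
  have "lamp_class m U = lamp_class m V \<longleftrightarrow> (\<exists>j. V = rotation (nat \<bar>m\<bar>) j U)"
    if "U \<subseteq> {0..<int (nat \<bar>m\<bar>)}" "V \<subseteq> {0..<int (nat \<bar>m\<bar>)}" for U V
    using that conjugate_window_iff[OF assms, of U V]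
      lamp_class_eq_iff[OF finite_window finite_window, of U _ V _ m m] by simp
  note card_rotation_classes[OF _ this, of k]
  then show "real (nat \<bar>m\<bar> choose k) / nat \<bar>m\<bar> \<le> card (window_classes m k)"
    "card (window_classes m k) \<le> real (nat \<bar>m\<bar> choose k) / nat \<bar>m\<bar> + 2 ^ (nat \<bar>m\<bar> div 2 + 1)"
    using assms by (simp_all add: window_classes_def)
qed

lemma classes_of_length:
  "{C \<in> conjugacy_classes lamplighter. class_length lamplighter lamplighter_gens C = n} =
    {C \<in> conjugacy_classes lamplighter. class_length lamplighter lamplighter_gens C = n
      \<and> (\<exists>A. finite A \<and> C = lamp_class 0 A)} \<union>
    (\<Union>m\<in>{- int n..int n} - {0}. window_classes m (n - nat \<bar>m\<bar>))" (is "?C = ?Z \<union> ?N")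
proof (intro equalityI subsetI)
  fix C assume C: "C \<in> ?C"
  then obtain m A where A: "finite A" "C = lamp_class m A"
    by (auto simp: conjugacy_classes_lamplighter)
  show "C \<in> ?Z \<union> ?N"
  proof (cases "m = 0")
    case True
    then show ?thesis using A C by blast
  next
    case False
    obtain U where U: "U \<subseteq> {0..<\<bar>m\<bar>}" "conjugate m A U"
      using conjugate_window[OF False A(1)] .
    then have CU: "C = lamp_class m U"
      using lamp_class_eq_iff[OF A(1) finite_window[OF U(1)]] A(2) by simp
    then have "nat \<bar>m\<bar> + card U = n"
      using class_length_window[OF False U(1)] C by simp
    then have "m \<in> {- int n..int n} - {0}" "card U = n - nat \<bar>m\<bar>" using False by auto
    then show ?thesis using U(1) CU unfolding window_classes_def by blast
  qed
next
  fix C assume "C \<in> ?Z \<union> ?N"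
  then show "C \<in> ?C"
  proof
    assume "C \<in> ?N"
    then obtain m U where m: "m \<in> {- int n..int n} - {0}" and U: "U \<subseteq> {0..<\<bar>m\<bar>}"
      "card U = n - nat \<bar>m\<bar>" "C = lamp_class m U"
      unfolding window_classes_def by blast
    have "C \<in> conjugacy_classes lamplighter"
      using finite_window[OF U(1)] U(3) unfolding conjugacy_classes_lamplighter by blast
    moreover have "class_length lamplighter lamplighter_gens C = n"
      using class_length_window[OF _ U(1)] m U(2,3) by auto
    ultimately show ?thesis by simp
  qed blast
qed

text \<open>
With \<open>k = n - M\<close>, the identity \<open>n * (M choose k) = M * (M choose k) + k * (M choose k)\<close> and the absorption
\<open>k * (M choose k) = M * ((M - 1) choose (k - 1))\<close> turn the summand, multiplied by \<open>n\<close>, into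
\<open>(M choose k) + ((M - 1) choose (k - 1))\<close>. Both parts are diagonal sums in Pascal's triangle.
\<close>

lemma lucas_sum:
  fixes p :: nat
  defines "n \<equiv> Suc (Suc p)"
  shows "(\<Sum>M\<in>{1..n}. real (M choose (n - M)) / M) = (fib (Suc n) + fib (Suc p)) / n"
proof -
  have "(\<Sum>M\<in>{1..n}. real (M choose (n - M)) / M)
      = (\<Sum>k\<in>{0..Suc p}. real ((n - k) choose k) / (n - k))"
    by (rule sum.reindex_bij_witness[of _ "\<lambda>k. n - k" "\<lambda>M. n - M"]) (auto simp: n_def)
  then have "real n * (\<Sum>M\<in>{1..n}. real (M choose (n - M)) / M)
      = (\<Sum>k\<in>{0..Suc p}. real n * (real ((n - k) choose k) / (n - k)))"
    by (simp only: sum_distrib_left)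
  also have "\<dots> = (\<Sum>k\<in>{0..Suc p}. real (((n - k) choose k) +
        (if k = 0 then 0 else (Suc p - k) choose (k - 1))))"
  proof (rule sum.cong)
    fix k assume k: "k \<in> {0..Suc p}"
    define M where "M = n - k"
    have M: "n = M + k" "M > 0" using k by (auto simp: M_def n_def)
    have "k * (M choose k) = M * (if k = 0 then 0 else (M - 1) choose (k - 1))"
      using times_binomial_minus1_eq[of k M] by simp
    then have "n * (M choose k) = M * ((M choose k) + (if k = 0 then 0 else (M - 1) choose (k - 1)))"
      by (simp add: M(1) algebra_simps)
    then have "real (n * (M choose k)) =
        real (M * ((M choose k) + (if k = 0 then 0 else (M - 1) choose (k - 1))))"
      by (simp only:)
    moreover have "M - 1 = Suc p - k" by (simp add: M_def n_def)
    ultimately show "real n * (real ((n - k) choose k) / (n - k)) =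
        real (((n - k) choose k) + (if k = 0 then 0 else (Suc p - k) choose (k - 1)))"
      using M(2) unfolding M_def[symmetric] by (simp add: field_simps)
  qed simp
  also have "\<dots> = real ((\<Sum>k\<in>{0..Suc p}. (n - k) choose k) +
      (\<Sum>k = 0..Suc p. if k = 0 then 0 else (Suc p - k) choose (k - 1)))"
    by (simp only: of_nat_sum[symmetric] sum.distrib)
  \<comment> \<open>The term \<open>k = n\<close> can be added because \<open>0 choose n = 0\<close> for \<open>n > 0\<close>.\<close>
  also have "(\<Sum>k\<in>{0..Suc p}. (n - k) choose k) = (\<Sum>k\<in>{0..n}. (n - k) choose k)"
    by (simp add: n_def)
  also have "\<dots> = fib (Suc n)" by (rule ne_diagonal_fib)
  also have "(\<Sum>k = 0..Suc p. if k = 0 then 0 else (Suc p - k) choose (k - 1)) = fib (Suc p)"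
    by (simp only: sum_choose_drop_zero ne_diagonal_fib)
  finally have "real n * (\<Sum>M\<in>{1..n}. real (M choose (n - M)) / M) = real (fib (Suc n) + fib (Suc p))" .
  moreover have "real n \<noteq> 0" by (simp add: n_def)
  ultimately show ?thesis by (metis nonzero_mult_div_cancel_left)
qed

lemma growth_bounds:
  fixes p :: nat
  defines "n \<equiv> Suc (Suc p)"
  defines "c \<equiv> fps_nth (conjugacy_growth_series lamplighter lamplighter_gens) n"
  defines "L \<equiv> real (fib (Suc n) + fib (Suc p))"
  shows "2 * (L / n) \<le> c" "c \<le> 2 * (L / n) + (2 * real n + 1) * 2 ^ (n div 2 + 1)"
proof -
  let ?Z = "{C \<in> conjugacy_classes lamplighter. class_length lamplighter lamplighter_gens C = n
      \<and> (\<exists>A. finite A \<and> C = lamp_class 0 A)}"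
  let ?I = "{- int n..int n} - {0}"
  let ?w = "\<lambda>m. window_classes m (n - nat \<bar>m\<bar>)"
  let ?N = "\<Union>m\<in>?I. ?w m"
  let ?b = "\<lambda>M. real (M choose (n - M)) / M"
  have finZ: "finite ?Z" by (rule finite_subset[OF _ finite_lamplighter_classes[of n]]) blast
  have finN: "finite ?N" using finite_window_classes by blast
  have c: "c = card (?Z \<union> ?N)"
    by (simp add: c_def conjugacy_growth_series_def classes_of_length)
  have N: "card ?N = (\<Sum>m\<in>?I. card (?w m))"
  proof (rule card_UN_disjoint)
    show "\<forall>m\<in>?I. \<forall>m'\<in>?I. m \<noteq> m' \<longrightarrow> ?w m \<inter> ?w m' = {}"
    proof (intro ballI impI)
      fix m m' :: int assume "m \<noteq> m'"
      then show "?w m \<inter> ?w m' = {}"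
        using lamp_class_eq_iff[OF finite_window finite_window, of _ _ _ _ m m']
        by (auto simp: window_classes_def)
    qed
  qed (use finite_window_classes in auto)
  have two: "(\<Sum>m\<in>?I. g (nat \<bar>m\<bar>)) = 2 * (\<Sum>M\<in>{1..n}. g M)" for g :: "nat \<Rightarrow> real"
  proof -
    have "?I = int ` {1..n} \<union> (\<lambda>M. - int M) ` {1..n}"
    proof (intro equalityI subsetI)
      fix m assume "m \<in> ?I"
      then show "m \<in> int ` {1..n} \<union> (\<lambda>M. - int M) ` {1..n}"
        by (cases "m > 0") (auto intro!: image_eqI[of _ _ "nat \<bar>m\<bar>"])
    qed auto
    moreover have "int ` {1..n} \<inter> (\<lambda>M. - int M) ` {1..n} = {}" by auto
    ultimately have "(\<Sum>m\<in>?I. g (nat \<bar>m\<bar>)) = (\<Sum>m\<in>int ` {1..n}. g (nat \<bar>m\<bar>)) +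
        (\<Sum>m\<in>(\<lambda>M. - int M) ` {1..n}. g (nat \<bar>m\<bar>))"
      by (simp only: sum.union_disjoint finite_imageI finite_atLeastAtMost)
    then show ?thesis by (simp add: sum.reindex inj_on_def)
  qed
  have sum_b: "(\<Sum>m\<in>?I. ?b (nat \<bar>m\<bar>)) = 2 * (L / n)"
    using two[of ?b] lucas_sum[of p] by (simp only: L_def n_def)
  have "2 * (L / n) \<le> (\<Sum>m\<in>?I. real (card (?w m)))"
    unfolding sum_b[symmetric] by (intro sum_mono card_window_classes) simp
  also have "\<dots> = card ?N" by (simp only: N of_nat_sum)
  also have "\<dots> \<le> c" unfolding c using finZ finN by (intro of_nat_mono card_mono) auto
  finally show "2 * (L / n) \<le> c" .
  have "real c \<le> real (card ?Z) + real (card ?N)"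
    unfolding c using card_Un_le[of ?Z ?N] by linarith
  also have "real (card ?Z) \<le> 2 ^ (n div 2 + 1)"
    using of_nat_mono[OF card_torsion_classes[of n], where 'a = real] by simp
  also have "real (card ?N) = (\<Sum>m\<in>?I. real (card (?w m)))" by (simp only: N of_nat_sum)
  also have "\<dots> \<le> (\<Sum>m\<in>?I. ?b (nat \<bar>m\<bar>) + 2 ^ (nat \<bar>m\<bar> div 2 + 1))"
    by (intro sum_mono card_window_classes) simp
  also have "\<dots> \<le> (\<Sum>m\<in>?I. ?b (nat \<bar>m\<bar>) + 2 ^ (n div 2 + 1))"
  proof (intro sum_mono add_left_mono power_increasing)
    fix m assume "m \<in> ?I"
    then have "nat \<bar>m\<bar> \<le> n" by auto
    then show "nat \<bar>m\<bar> div 2 + 1 \<le> n div 2 + 1" using div_le_mono by simp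
  qed simp
  also have "\<dots> = 2 * (L / n) + real (card ?I) * 2 ^ (n div 2 + 1)"
    by (simp only: sum.distrib sum_b sum_constant)
  also have "card ?I = 2 * n" by (simp add: nat_add_distrib)
  finally show "c \<le> 2 * (L / n) + (2 * real n + 1) * 2 ^ (n div 2 + 1)"
    by (simp add: algebra_simps)
qed

section \<open>The limit\<close>

lemma lucas_closed_form:
  fixes \<phi> \<psi> :: real
  defines "\<phi> \<equiv> (1 + sqrt 5) / 2" and "\<psi> \<equiv> (1 - sqrt 5) / 2"
  shows "real (fib (Suc (Suc (Suc p))) + fib (Suc p)) = \<phi> ^ Suc (Suc p) + \<psi> ^ Suc (Suc p)"
proof (induction p rule: fib.induct)
  case (3 p)
  have sq: "\<phi> * \<phi> = \<phi> + 1" "\<psi> * \<psi> = \<psi> + 1" by (simp_all add: \<phi>_def \<psi>_def field_simps)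
  have rec: "x ^ Suc (Suc (Suc (Suc p))) = x ^ Suc (Suc (Suc p)) + x ^ Suc (Suc p)" if "x * x = x + 1" for x :: real
    using arg_cong[OF that, of "\<lambda>y. x ^ Suc (Suc p) * y"] by (simp add: algebra_simps)
  have "real (fib (Suc (Suc (Suc (Suc (Suc p))))) + fib (Suc (Suc (Suc p)))) =
      real (fib (Suc (Suc (Suc (Suc p)))) + fib (Suc (Suc p))) + real (fib (Suc (Suc (Suc p))) + fib (Suc p))"
    using fib.simps(3)[of "Suc (Suc (Suc p))"] fib.simps(3)[of "Suc p"] by linarith
  then show ?case unfolding 3 rec[OF sq(1)] rec[OF sq(2)] by (simp only: add_ac)
qed (simp_all add: \<phi>_def \<psi>_def field_simps power2_eq_square power3_eq_cube numeral_eq_Suc)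

lemma quadratic_times_power_tendsto_0:
  fixes r :: real
  assumes "0 \<le> r" "r < 1"
  shows "(\<lambda>n. real n ^ 2 * r ^ n) \<longlonglongrightarrow> 0"
proof -
  \<comment> \<open>The sequence is the square of \<open>n * sqrt r ^ n\<close>.\<close>
  have "(\<lambda>n. of_nat n * sqrt r ^ n) \<longlonglongrightarrow> 0"
    by (rule powser_times_n_limit_0) (use assms in simp)
  from tendsto_power[OF this, of 2] show ?thesis
    using assms by (simp add: power_mult_distrib flip: real_sqrt_power)
qed

theorem mainTheorem6:
  shows "(\<lambda>m. real (fps_nth (conjugacy_growth_series lamplighter lamplighter_gens) m)
            / (2 / real m * ((1 + sqrt 5) / 2) ^ m)) \<longlonglongrightarrow> 1"
proof -
  define \<phi> \<psi> :: real where "\<phi> = (1 + sqrt 5) / 2" and "\<psi> = (1 - sqrt 5) / 2"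
  define r where "r = sqrt 2 / \<phi>"
  let ?c = "\<lambda>m. real (fps_nth (conjugacy_growth_series lamplighter lamplighter_gens) m)"
  have s5: "2 < sqrt 5" "sqrt 5 < 3" by (auto intro: real_less_rsqrt real_less_lsqrt)
  then have \<phi>: "3/2 < \<phi>" "\<bar>\<psi>\<bar> < \<phi>" by (auto simp: \<phi>_def \<psi>_def)
  have "sqrt 2 < 3/2" by (rule real_less_lsqrt) (simp_all add: power2_eq_square)
  with \<phi>(1) have r: "0 \<le> r" "r < 1" by (simp_all add: r_def)
  have bounds: "1 + (\<psi> / \<phi>) ^ m \<le> ?c m / (2 / real m * \<phi> ^ m) \<and>
      ?c m / (2 / real m * \<phi> ^ m) \<le> 1 + (\<psi> / \<phi>) ^ m + 3 * (real m ^ 2 * r ^ m)"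
    if "m \<ge> 2" for m
  proof -
    from le_Suc_ex[OF that] obtain p where "m = 2 + p" by blast
    then have p: "m = Suc (Suc p)" by simp
    have L: "real (fib (Suc m) + fib (Suc p)) = \<phi> ^ m + \<psi> ^ m"
      using lucas_closed_form[of p] by (simp only: p \<phi>_def \<psi>_def)
    have low: "2 * ((\<phi> ^ m + \<psi> ^ m) / m) \<le> ?c m"
      and up: "?c m \<le> 2 * ((\<phi> ^ m + \<psi> ^ m) / m) + (2 * real m + 1) * 2 ^ (m div 2 + 1)"
      using growth_bounds[of p] by (simp_all only: p[symmetric] L)
    define D where "D = 2 / real m * \<phi> ^ m"
    have D: "D > 0" using that \<phi>(1) by (simp add: D_def)
    have main: "2 * ((\<phi> ^ m + \<psi> ^ m) / m) / D = 1 + (\<psi> / \<phi>) ^ m"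
      using that \<phi>(1) by (simp add: D_def field_simps power_divide)
    have "(2 * real m + 1) * 2 ^ (m div 2 + 1) \<le> (3 * real m) * (2 * sqrt 2 ^ m)"
    proof (intro mult_mono)
      have "(2::real) ^ (m div 2) = sqrt 2 ^ (2 * (m div 2))" by (simp add: power_mult)
      also have "\<dots> \<le> sqrt 2 ^ m" by (intro power_increasing) auto
      finally show "(2::real) ^ (m div 2 + 1) \<le> 2 * sqrt 2 ^ m" by simp
    qed (use that in auto)
    also have "\<dots> = 3 * (real m ^ 2 * r ^ m) * D"
      using that \<phi>(1) by (simp add: D_def r_def field_simps power_divide power2_eq_square)
    finally have "((2 * real m + 1) * 2 ^ (m div 2 + 1)) / D \<le> 3 * (real m ^ 2 * r ^ m)"
      using D by (simp add: divide_le_eq)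
    moreover have "?c m / D \<le> 2 * ((\<phi> ^ m + \<psi> ^ m) / m) / D + ((2 * real m + 1) * 2 ^ (m div 2 + 1)) / D"
      using divide_right_mono[OF up, of D] D by (simp only: add_divide_distrib)
    moreover have "2 * ((\<phi> ^ m + \<psi> ^ m) / m) / D \<le> ?c m / D"
      using low D by (intro divide_right_mono) auto
    ultimately show ?thesis unfolding main D_def[symmetric] by linarith
  qed
  have "\<bar>\<psi> / \<phi>\<bar> < 1" using \<phi> by simp
  then have q: "(\<lambda>m. (\<psi> / \<phi>) ^ m) \<longlonglongrightarrow> 0" by (intro LIMSEQ_power_zero) simp
  have lower: "(\<lambda>m. 1 + (\<psi> / \<phi>) ^ m) \<longlonglongrightarrow> 1"
    using tendsto_add[OF tendsto_const q, of 1] by simp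
  have upper: "(\<lambda>m. 1 + (\<psi> / \<phi>) ^ m + 3 * (real m ^ 2 * r ^ m)) \<longlonglongrightarrow> 1"
    using tendsto_add[OF lower tendsto_mult_left[OF quadratic_times_power_tendsto_0[OF r], of 3]] by simp
  have "(\<lambda>m. ?c m / (2 / real m * \<phi> ^ m)) \<longlonglongrightarrow> 1"
  proof (rule tendsto_sandwich[OF _ _ lower upper])
    show "\<forall>\<^sub>F m in sequentially. 1 + (\<psi> / \<phi>) ^ m \<le> ?c m / (2 / real m * \<phi> ^ m)"
      using eventually_ge_at_top[of 2] by eventually_elim (use bounds in blast)
    show "\<forall>\<^sub>F m in sequentially. ?c m / (2 / real m * \<phi> ^ m) \<le> 1 + (\<psi> / \<phi>) ^ m + 3 * (real m ^ 2 * r ^ m)"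
      using eventually_ge_at_top[of 2] by eventually_elim (use bounds in blast)
  qed
  then show ?thesis by (simp only: \<phi>_def)
qed

end
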